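(* Every tree-union-cycle graph is a $B_2$-EPG graph, and there exist Halin graphs that are not $B_1$-EPG graphs.
   Context: All graphs are finite and simple. A tree-union-cycle graph is a simple planar graph $G=T\cup C$, where $T$ is a tree and $C$ is a simple cycle (on at least three vertices) whose vertex set is exactly the set of all leaves of $T$ ($C$ is induced by the leaves of $T$). A Halin graph is a tree-union-cycle graph $G=T\cup C$ with no vertex of degree $2$. For an integer $k\ge 0$, a $k$-bend path is a piecewise linear simple curve in the plane made up of $k+1$ line segments, each of which is horizontal or vertical, with consecutive segments being of different orientation. A $B_k$-EPG representation of a graph $G$ is a collection of $k$-bend paths $\{P_u\}_{u\in V(G)}$ such that for distinct $u,v\in V(G)$, $uv\in E(G)$ if and only if $P_u$ and $P_v$ have a horizontal or vertical line segment of non-zero length in common. $G$ is a $B_k$-EPG graph if it has a $B_k$-EPG representation. *)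

theory Defs
  imports "Graph_Theory.Graph_Theory" "HOL-Analysis.Analysis"
begin

text \<open>
  A finite simple graph is a \<open>pair_graph\<close>: a finite, loopless, symmetric digraph whose arcs are
  pairs of vertices. The undirected edge \<open>uv\<close> is represented by both \<open>(u, v)\<close> and \<open>(v, u)\<close>.
  The plane is the type \<open>complex\<close>, with \<open>Re\<close> and \<open>Im\<close> as Cartesian coordinates.
\<close>

definition vertex_degree :: "'a pair_pre_digraph \<Rightarrow> 'a \<Rightarrow> nat" where
  "vertex_degree G v = out_degree (with_proj G) v"

text \<open>
  The directed cycle notion of the library admits \<open>[(u, v), (v, u)]\<close>, so a symmetric digraph with an
  edge is never a \<open>forest\<close> or a \<open>tree\<close> in the sense of the library. A simple cycle of an undirected
  simple graph is a directed cycle with at least three arcs.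
\<close>

definition simple_cycle :: "'a pair_pre_digraph \<Rightarrow> ('a \<times> 'a) list \<Rightarrow> bool" where
  "simple_cycle G p \<longleftrightarrow> pre_digraph.cycle (with_proj G) p \<and> 3 \<le> length p"

definition tree_graph :: "'a pair_pre_digraph \<Rightarrow> bool" where
  "tree_graph T \<longleftrightarrow>
     pair_graph T \<and> Digraph_Component.connected (with_proj T) \<and> (\<nexists>p. simple_cycle T p)"

definition leaves :: "'a pair_pre_digraph \<Rightarrow> 'a set" where
  "leaves T = {v \<in> pverts T. vertex_degree T v = 1}"

definition cycle_graph :: "'a pair_pre_digraph \<Rightarrow> bool" where
  "cycle_graph C \<longleftrightarrow> pair_graph C \<and>
     (\<exists>p. simple_cycle C p \<and> pverts C = fst ` set p \<and> parcs C = set p \<union> (set p)\<inverse>)"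

text \<open>
  A drawing in the plane: \<open>pos\<close> places the vertices and \<open>curve (u, v)\<close> is the curve representing the
  edge \<open>uv\<close>, which must be the same point set as \<open>curve (v, u)\<close>. Here \<open>arc\<close> is the notion from
  analysis (an injective path).
\<close>

definition planar :: "'a pair_pre_digraph \<Rightarrow> bool" where
  "planar G \<longleftrightarrow> (\<exists>(pos :: 'a \<Rightarrow> complex) (curve :: 'a \<times> 'a \<Rightarrow> real \<Rightarrow> complex).
     inj_on pos (pverts G) \<and>
     (\<forall>(u, v) \<in> parcs G.
        Path_Connected.arc (curve (u, v)) \<and>
        pathstart (curve (u, v)) = pos u \<and> pathfinish (curve (u, v)) = pos v \<and>
        path_image (curve (v, u)) = path_image (curve (u, v)) \<and>
        path_image (curve (u, v)) \<inter> pos ` pverts G = {pos u, pos v}) \<and>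
     (\<forall>(u, v) \<in> parcs G. \<forall>(x, y) \<in> parcs G. {u, v} \<noteq> {x, y} \<longrightarrow>
        path_image (curve (u, v)) \<inter> path_image (curve (x, y)) = pos ` ({u, v} \<inter> {x, y})))"

definition tree_union_cycle_graph :: "'a pair_pre_digraph \<Rightarrow> bool" where
  "tree_union_cycle_graph G \<longleftrightarrow> pair_graph G \<and> planar G \<and>
     (\<exists>T C. tree_graph T \<and> cycle_graph C \<and> pverts C = leaves T \<and>
        G = \<lparr>pverts = pverts T \<union> pverts C, parcs = parcs T \<union> parcs C\<rparr>)"

definition halin_graph :: "'a pair_pre_digraph \<Rightarrow> bool" where
  "halin_graph G \<longleftrightarrow> tree_union_cycle_graph G \<and> (\<forall>v \<in> pverts G. vertex_degree G v \<noteq> 2)"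

definition horizontal :: "complex \<Rightarrow> complex \<Rightarrow> bool" where
  "horizontal a b \<longleftrightarrow> a \<noteq> b \<and> Im a = Im b"

definition vertical :: "complex \<Rightarrow> complex \<Rightarrow> bool" where
  "vertical a b \<longleftrightarrow> a \<noteq> b \<and> Re a = Re b"

fun polyline :: "complex list \<Rightarrow> real \<Rightarrow> complex" where
  "polyline (a # b # c # ps) = linepath a b +++ polyline (b # c # ps)"
| "polyline [a, b] = linepath a b"
| "polyline [a] = linepath a a"
| "polyline [] = linepath 0 0"

text \<open>
  The \<open>k + 2\<close> points \<open>ps\<close> are the start, the \<open>k\<close> bends and the end of the path. A segment is never
  both horizontal and vertical, because its endpoints are distinct.
\<close>

definition bend_path :: "nat \<Rightarrow> (real \<Rightarrow> complex) \<Rightarrow> bool" where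
  "bend_path k \<gamma> \<longleftrightarrow> (\<exists>ps. length ps = k + 2 \<and> \<gamma> = polyline ps \<and> Path_Connected.arc \<gamma> \<and>
     (\<forall>i\<le>k. horizontal (ps ! i) (ps ! (i + 1)) \<or> vertical (ps ! i) (ps ! (i + 1))) \<and>
     (\<forall>i<k. horizontal (ps ! i) (ps ! (i + 1)) \<longleftrightarrow> vertical (ps ! (i + 1)) (ps ! (i + 2))))"

definition share_segment :: "(real \<Rightarrow> complex) \<Rightarrow> (real \<Rightarrow> complex) \<Rightarrow> bool" where
  "share_segment \<gamma> \<delta> \<longleftrightarrow> (\<exists>a b. (horizontal a b \<or> vertical a b) \<and>
     closed_segment a b \<subseteq> path_image \<gamma> \<inter> path_image \<delta>)"

definition EPG_representation ::
    "nat \<Rightarrow> 'a pair_pre_digraph \<Rightarrow> ('a \<Rightarrow> real \<Rightarrow> complex) \<Rightarrow> bool" where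
  "EPG_representation k G P \<longleftrightarrow> (\<forall>u \<in> pverts G. bend_path k (P u)) \<and>
     (\<forall>u \<in> pverts G. \<forall>v \<in> pverts G. u \<noteq> v \<longrightarrow>
        ((u, v) \<in> parcs G \<longleftrightarrow> share_segment (P u) (P v)))"

definition EPG_graph :: "nat \<Rightarrow> 'a pair_pre_digraph \<Rightarrow> bool" where
  "EPG_graph k G \<longleftrightarrow> pair_graph G \<and> (\<exists>P. EPG_representation k G P)"

end

theory Submission
  imports Defs
begin

text \<open>
  For two bends, give every inner vertex of the tree a horizontal line of its own. A leaf path has three
  segments: the middle one touches the line of its parent, and the two vertical ones touch the leaf paths
  before and after it on the cycle, so that the leaves form a row of U-shapes. The tree edges between inner
  vertices are realised to the right of this row.

  For one bend, the wheel with five spokes is a Halin graph that has no representation. Each rim path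
  shares a segment with the L-shaped path of the hub. Unfolding the L to a line turns the rim paths into
  intervals such that overlapping intervals belong to adjacent vertices and strictly separated ones to
  non-adjacent vertices. This is impossible for a 5-cycle.
\<close>

section \<open>Grid paths\<close>

text \<open>A path has only three segments, but an inner vertex may have any number of children and
  must also meet its own parent. So all children meet a vertex on its one long line, each in a
  separate stretch, and the vertex spends its bends on reaching one unit of its parent's line. A
  labelling that decreases towards the root gives both the heights of the lines and the order of the
  columns, so that a parent's line always extends beyond the columns of its children. Rooting at a
  leaf \<open>s\<close> makes the one tree neighbour of \<open>s\<close> the root of the inner
  vertices; it has no parent line to reach and is free to meet \<open>s\<close>.

  In the unfolding for one bend, intervals that merely touch carry no information: two paths that
  touch at the hub's corner can still share a segment on the far side of it. The rim must therefore
  contradict the interval conditions even when touching is allowed. A 4-cycle does not: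
  \<open>[-1, 0]\<close> taken twice and \<open>[0, 1]\<close> taken twice satisfy all the
  conditions. The 5-cycle is the shortest one that does.\<close>

definition grid_set :: "(real \<times> real \<times> real) set \<Rightarrow> (real \<times> real \<times> real) set \<Rightarrow> complex set" where
  "grid_set H V = {z. (\<exists>(y, l, r) \<in> H. Im z = y \<and> l \<le> Re z \<and> Re z \<le> r) \<or>
                      (\<exists>(x, l, r) \<in> V. Re z = x \<and> l \<le> Im z \<and> Im z \<le> r)}"

text \<open>Both families of \<open>grid_set\<close> hold triples (fixed coordinate, lower end,
  upper end), so one relation serves both orientations. The strict inequality excludes common points
  without length.\<close>

definition overlap :: "(real \<times> real \<times> real) set \<Rightarrow> (real \<times> real \<times> real) set \<Rightarrow> bool" where
  "overlap A B \<longleftrightarrow> (\<exists>(c, l, r) \<in> A. \<exists>(c', l', r') \<in> B. c = c' \<and> max l l' < min r r')"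

text \<open>Read \<open>J\<close> as positions along the line with coordinate \<open>c\<close>.
  Perpendicular segments cover only finitely many of them, so infinitely many lie in parallel
  segments of both sets; by pigeonhole one pair of segments has infinitely many common points, hence
  a common part of positive length. Exchanging the two coordinates gives the vertical case.\<close>

lemma overlap_if_infinite_common:
  fixes J :: "real set"
  assumes fin: "finite H" "finite V" "finite H'" "finite V'" and inf: "infinite J"
    and 1: "\<And>t. t \<in> J \<Longrightarrow> (\<exists>(y, l, r) \<in> H. c = y \<and> l \<le> t \<and> t \<le> r) \<or> (\<exists>(x, l, r) \<in> V. t = x \<and> l \<le> c \<and> c \<le> r)"
    and 2: "\<And>t. t \<in> J \<Longrightarrow> (\<exists>(y, l, r) \<in> H'. c = y \<and> l \<le> t \<and> t \<le> r) \<or> (\<exists>(x, l, r) \<in> V'. t = x \<and> l \<le> c \<and> c \<le> r)"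
  shows "overlap H H'"
proof -
  define K where "K = (\<lambda>((y, l, r), (y', l', r')). {t :: real. c = y \<and> c = y' \<and> max l l' \<le> t \<and> t \<le> min r r'})"
  have "J \<subseteq> \<Union> (K ` (H \<times> H')) \<union> fst ` V \<union> fst ` V'"
  proof
    fix t assume "t \<in> J"
    show "t \<in> \<Union> (K ` (H \<times> H')) \<union> fst ` V \<union> fst ` V'"
    proof (cases "t \<in> fst ` V \<union> fst ` V'")
      case False
      have "\<exists>(y, l, r) \<in> H. c = y \<and> l \<le> t \<and> t \<le> r" "\<exists>(y, l, r) \<in> H'. c = y \<and> l \<le> t \<and> t \<le> r"
        using 1[OF \<open>t \<in> J\<close>] 2[OF \<open>t \<in> J\<close>] False image_eqI[of t fst] by (auto simp: split_beta)
      then obtain y l r y' l' r' where "(y, l, r) \<in> H" "c = y \<and> l \<le> t \<and> t \<le> r"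
        "(y', l', r') \<in> H'" "c = y' \<and> l' \<le> t \<and> t \<le> r'"
        by auto
      then have "t \<in> K ((y, l, r), (y', l', r'))" "((y, l, r), (y', l', r')) \<in> H \<times> H'"
        by (auto simp: K_def)
      then show ?thesis by blast
    qed blast
  qed
  then have "infinite (\<Union> (K ` (H \<times> H')))"
    using inf fin by (meson finite_UnI finite_imageI infinite_super)
  then obtain p where p: "p \<in> H \<times> H'" "infinite (K p)"
    using fin by auto
  obtain y l r y' l' r' where pe: "p = ((y, l, r), (y', l', r'))" by (metis surj_pair)
  have "c = y" "c = y'"
    using p(2) infinite_imp_nonempty unfolding pe K_def by fastforce+
  moreover have "max l l' < min r r'"
  proof (rule ccontr)
    assume "\<not> ?thesis"
    then have "K p \<subseteq> {max l l'}" unfolding pe K_def by auto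
    then show False using p(2) finite_subset by blast
  qed
  ultimately show ?thesis using p(1) unfolding pe overlap_def by fastforce
qed

lemma closed_segment_horizontal:
  "closed_segment (Complex a y) (Complex b y) = {z. Im z = y \<and> min a b \<le> Re z \<and> Re z \<le> max a b}"
  by (auto simp: closed_segment_same_Im closed_segment_eq_real_ivl)

lemma closed_segment_vertical:
  "closed_segment (Complex x a) (Complex x b) = {z. Re z = x \<and> min a b \<le> Im z \<and> Im z \<le> max a b}"
  by (auto simp: closed_segment_same_Re closed_segment_eq_real_ivl)

lemma grid_set_horizontal:
  assumes "(y, l, r) \<in> H" "Im z = y" "l \<le> Re z" "Re z \<le> r"
  shows "z \<in> grid_set H V"
  using assms unfolding grid_set_def by blast

lemma grid_set_vertical:
  assumes "(x, l, r) \<in> V" "Re z = x" "l \<le> Im z" "Im z \<le> r"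
  shows "z \<in> grid_set H V"
  using assms unfolding grid_set_def by blast

text \<open>Makes adjacency combinatorial: a common segment has infinitely many points on one line,
  and conversely the stretch from \<open>max l l'\<close> to \<open>min r r'\<close> is itself a
  shared segment.\<close>

lemma share_segment_grid:
  assumes \<gamma>: "path_image \<gamma> = grid_set H V" and \<delta>: "path_image \<delta> = grid_set H' V'"
    and fin: "finite H" "finite V" "finite H'" "finite V'"
  shows "share_segment \<gamma> \<delta> \<longleftrightarrow> overlap H H' \<or> overlap V V'"
proof
  assume "share_segment \<gamma> \<delta>"
  then obtain a b where ab: "horizontal a b \<or> vertical a b"
    and sub: "closed_segment a b \<subseteq> grid_set H V \<inter> grid_set H' V'"
    unfolding share_segment_def \<gamma> \<delta> by blast
  from ab show "overlap H H' \<or> overlap V V'"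
  proof
    assume h: "horizontal a b"
    have "Complex t (Im a) \<in> closed_segment a b" if "t \<in> closed_segment (Re a) (Re b)" for t
      using that h by (auto simp: closed_segment_same_Im horizontal_def)
    with sub have *: "Complex t (Im a) \<in> grid_set H V" "Complex t (Im a) \<in> grid_set H' V'"
      if "t \<in> closed_segment (Re a) (Re b)" for t using that by blast+
    have "infinite (closed_segment (Re a) (Re b))"
      using h by (auto simp: horizontal_def complex_eq_iff)
    then have "overlap H H'"
      by (rule overlap_if_infinite_common[OF fin, where c = "Im a"]) (use * in \<open>auto simp: grid_set_def\<close>)
    then show ?thesis ..
  next
    assume h: "vertical a b"
    have "Complex (Re a) t \<in> closed_segment a b" if "t \<in> closed_segment (Im a) (Im b)" for t
      using that h by (auto simp: closed_segment_same_Re vertical_def)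
    with sub have *: "Complex (Re a) t \<in> grid_set H V" "Complex (Re a) t \<in> grid_set H' V'"
      if "t \<in> closed_segment (Im a) (Im b)" for t using that by blast+
    have "infinite (closed_segment (Im a) (Im b))"
      using h by (auto simp: vertical_def complex_eq_iff)
    then have "overlap V V'"
      by (rule overlap_if_infinite_common[OF fin(2,1,4,3), where c = "Re a"]) (use * in \<open>auto simp: grid_set_def\<close>)
    then show ?thesis ..
  qed
next
  assume "overlap H H' \<or> overlap V V'"
  then show "share_segment \<gamma> \<delta>"
  proof
    assume "overlap H H'"
    then obtain y l r l' r' where *: "(y, l, r) \<in> H" "(y, l', r') \<in> H'" "max l l' < min r r'"
      unfolding overlap_def by auto
    have "horizontal (Complex (max l l') y) (Complex (min r r') y)"
      using * by (auto simp: horizontal_def complex_eq_iff)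
    moreover have "closed_segment (Complex (max l l') y) (Complex (min r r') y) \<subseteq> grid_set H V \<inter> grid_set H' V'"
      unfolding closed_segment_horizontal
      using grid_set_horizontal[OF *(1)] grid_set_horizontal[OF *(2)] *(3) by (force simp: min_def max_def split: if_splits)
    ultimately show ?thesis unfolding share_segment_def \<gamma> \<delta> by blast
  next
    assume "overlap V V'"
    then obtain y l r l' r' where *: "(y, l, r) \<in> V" "(y, l', r') \<in> V'" "max l l' < min r r'"
      unfolding overlap_def by auto
    have "vertical (Complex y (max l l')) (Complex y (min r r'))"
      using * by (auto simp: vertical_def complex_eq_iff)
    moreover have "closed_segment (Complex y (max l l')) (Complex y (min r r')) \<subseteq> grid_set H V \<inter> grid_set H' V'"
      unfolding closed_segment_vertical
      using grid_set_vertical[OF *(1)] grid_set_vertical[OF *(2)] *(3) by (force simp: min_def max_def split: if_splits)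
    ultimately show ?thesis unfolding share_segment_def \<gamma> \<delta> by blast
  qed
qed

section \<open>Paths with two bends and with one bend as grid sets\<close>

lemma arc_polyline4:
  assumes "a \<noteq> b" "b \<noteq> c" "c \<noteq> d"
    and "closed_segment a b \<inter> closed_segment b c \<subseteq> {b}"
    and "closed_segment b c \<inter> closed_segment c d \<subseteq> {c}"
    and "closed_segment a b \<inter> closed_segment c d = {}"
  shows "Path_Connected.arc (polyline [a, b, c, d])"
proof -
  have "Path_Connected.arc (linepath b c +++ linepath c d)"
    by (rule arc_join) (use assms in auto)
  then have "Path_Connected.arc (linepath a b +++ (linepath b c +++ linepath c d))"
    by (intro arc_join) (use assms in \<open>auto simp: path_image_join\<close>)
  then show ?thesis by simp
qed

lemma hvh_path:
  assumes "a \<noteq> x" "y \<noteq> y'" "x \<noteq> b"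
  defines "\<gamma> \<equiv> polyline [Complex a y, Complex x y, Complex x y', Complex b y']"
  shows "bend_path 2 \<gamma>"
    and "path_image \<gamma> = grid_set {(y, min a x, max a x), (y', min x b, max x b)} {(x, min y y', max y y')}"
proof -
  have "Path_Connected.arc \<gamma>"
    unfolding \<gamma>_def using assms(1-3)
    by (intro arc_polyline4)
      (auto simp: closed_segment_horizontal closed_segment_vertical complex_eq_iff)
  then show "bend_path 2 \<gamma>"
    unfolding bend_path_def using assms(1-3)
    by (intro exI[of _ "[Complex a y, Complex x y, Complex x y', Complex b y']"])
      (auto simp: \<gamma>_def numeral_2_eq_2 le_Suc_eq less_Suc_eq horizontal_def vertical_def)
  show "path_image \<gamma> = grid_set {(y, min a x, max a x), (y', min x b, max x b)} {(x, min y y', max y y')}"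
    unfolding \<gamma>_def grid_set_def
    by (auto simp: path_image_join closed_segment_horizontal closed_segment_vertical)
qed

lemma vhv_path:
  assumes "a \<noteq> y" "x \<noteq> x'" "y \<noteq> b"
  defines "\<gamma> \<equiv> polyline [Complex x a, Complex x y, Complex x' y, Complex x' b]"
  shows "bend_path 2 \<gamma>"
    and "path_image \<gamma> = grid_set {(y, min x x', max x x')} {(x, min a y, max a y), (x', min y b, max y b)}"
proof -
  have "Path_Connected.arc \<gamma>"
    unfolding \<gamma>_def using assms(1-3)
    by (intro arc_polyline4)
      (auto simp: closed_segment_horizontal closed_segment_vertical complex_eq_iff)
  then show "bend_path 2 \<gamma>"
    unfolding bend_path_def using assms(1-3)
    by (intro exI[of _ "[Complex x a, Complex x y, Complex x' y, Complex x' b]"])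
      (auto simp: \<gamma>_def numeral_2_eq_2 le_Suc_eq less_Suc_eq horizontal_def vertical_def)
  show "path_image \<gamma> = grid_set {(y, min x x', max x x')} {(x, min a y, max a y), (x', min y b, max y b)}"
    unfolding \<gamma>_def grid_set_def
    by (auto simp: path_image_join closed_segment_horizontal closed_segment_vertical)
qed

text \<open>Reversing the path exchanges the two possible orders of its segments, so what matters is
  the corner \<open>(x, y)\<close> and the free end of each leg.\<close>

lemma bend_path_1_grid:
  assumes "bend_path 1 \<gamma>"
  obtains x y h k where "h \<noteq> x" "k \<noteq> y"
    "path_image \<gamma> = grid_set {(y, min x h, max x h)} {(x, min y k, max y k)}"
proof -
  from assms obtain ps where "length ps = 3" and \<gamma>: "\<gamma> = polyline ps"
    and hv: "\<forall>i\<le>1. horizontal (ps ! i) (ps ! (i + 1)) \<or> vertical (ps ! i) (ps ! (i + 1))"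
      "horizontal (ps ! 0) (ps ! 1) \<longleftrightarrow> vertical (ps ! 1) (ps ! 2)"
    unfolding bend_path_def by (auto simp: numeral_3_eq_3 numeral_2_eq_2)
  then obtain a b c where ps: "ps = [a, b, c]"
    by (auto simp: length_Suc_conv numeral_3_eq_3)
  have im: "path_image \<gamma> = closed_segment a b \<union> closed_segment b c"
    by (simp add: \<gamma> ps path_image_join)
  have 1: "horizontal a b \<or> vertical a b" "horizontal b c \<or> vertical b c"
    using hv(1)[rule_format, of 0] hv(1)[rule_format, of 1] by (auto simp: ps)
  obtain ax ay bx "by" cx cy where e: "a = Complex ax ay" "b = Complex bx by" "c = Complex cx cy"
    by (meson complex.exhaust)
  consider "horizontal a b" "vertical b c" | "vertical a b" "horizontal b c"
    using 1 hv(2) by (auto simp: ps)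
  then show thesis
  proof cases
    case 1
    then have "ay = by" "cx = bx" "ax \<noteq> bx" "cy \<noteq> by"
      by (auto simp: e horizontal_def vertical_def)
    moreover from this have "path_image \<gamma> = grid_set {(by, min bx ax, max bx ax)} {(bx, min by cy, max by cy)}"
      unfolding im e grid_set_def
      by (auto simp: closed_segment_horizontal closed_segment_vertical min.commute max.commute)
    ultimately show ?thesis by (intro that)
  next
    case 2
    then have "ax = bx" "cy = by" "cx \<noteq> bx" "ay \<noteq> by"
      by (auto simp: e horizontal_def vertical_def)
    moreover from this have "path_image \<gamma> = grid_set {(by, min bx cx, max bx cx)} {(bx, min by ay, max by ay)}"
      unfolding im e grid_set_def
      by (auto simp: closed_segment_horizontal closed_segment_vertical min.commute max.commute)
    ultimately show ?thesis by (intro that)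
  qed
qed

section \<open>Rooted trees and cycles\<close>

lemma vertex_degree_eq: "vertex_degree G v = card {w. (v, w) \<in> parcs G}"
proof -
  have "out_arcs (with_proj G) v = Pair v ` {w. (v, w) \<in> parcs G}"
    by (auto simp: out_arcs_def)
  then show ?thesis
    by (simp add: vertex_degree_def out_degree_def card_image inj_on_def)
qed

text \<open>Prepend vertices to a path and, when the new vertex already occurs, cut off the part
  before its occurrence. The bound on \<open>set xs\<close> later keeps the path inside a given part
  of the tree.\<close>

lemma rtrancl_imp_distinct_path:
  assumes "(x, y) \<in> R\<^sup>*"
  shows "\<exists>xs. xs \<noteq> [] \<and> hd xs = x \<and> last xs = y \<and> distinct xs \<and> set xs \<subseteq> insert y (Domain R) \<and>
    successively (\<lambda>a b. (a, b) \<in> R) xs"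
  using assms
proof (induction rule: converse_rtrancl_induct)
  case base
  then show ?case by (intro exI[of _ "[y]"]) simp
next
  case (step x z)
  then obtain xs where xs: "xs \<noteq> []" "hd xs = z" "last xs = y" "distinct xs" "set xs \<subseteq> insert y (Domain R)"
    "successively (\<lambda>a b. (a, b) \<in> R) xs" by blast
  show ?case
  proof (cases "x \<in> set xs")
    case True
    then obtain us vs where "xs = us @ x # vs" by (meson split_list)
    with xs show ?thesis
      by (intro exI[of _ "x # vs"]) (auto simp: successively_append_iff)
  next
    case False
    with xs step show ?thesis
      by (intro exI[of _ "x # xs"]) (auto simp: successively_Cons)
  qed
qed

text \<open>\<open>zip ys (tl ys)\<close> is the arc list of the walk with vertex list
  \<open>ys\<close>. Cycles are arc lists, whereas cutting and closing paths is easier on vertex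
  lists.\<close>

lemma pcas_zip_tl: "ys \<noteq> [] \<Longrightarrow> pcas (hd ys) (zip ys (tl ys)) (last ys)"
  by (induction ys rule: induct_list012) auto

lemma pawalk_verts_zip_tl: "ys \<noteq> [] \<Longrightarrow> pawalk_verts (hd ys) (zip ys (tl ys)) = ys"
  by (induction ys rule: induct_list012) auto

lemma successively_zip_tl: "successively (\<lambda>a b. (a, b) \<in> R) ys \<Longrightarrow> set (zip ys (tl ys)) \<subseteq> R"
  by (induction ys rule: induct_list012) auto

lemma pcas_eq_zip:
  assumes "pcas u p v"
  shows "p = zip (u # map snd p) (map snd p)" "last (u # map snd p) = v" "pawalk_verts u p = u # map snd p"
proof -
  have "p = zip (u # map snd p) (map snd p) \<and> last (u # map snd p) = v \<and> pawalk_verts u p = u # map snd p"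
    using assms
  proof (induction p arbitrary: u)
    case (Cons e p)
    then have "fst e = u" "pcas (snd e) p v" by auto
    with Cons.IH[of "snd e"] show ?case by (cases e) simp
  qed simp
  then show "p = zip (u # map snd p) (map snd p)" "last (u # map snd p) = v" "pawalk_verts u p = u # map snd p"
    by blast+
qed

text \<open>Closes a path whose two ends are neighbours of an outside vertex \<open>w\<close>; with
  at least two path vertices the closed walk has the three arcs that \<open>simple_cycle\<close>
  demands.\<close>

lemma simple_cycle_through:
  assumes "pair_wf_digraph T" and "distinct xs" "2 \<le> length xs" "w \<notin> set xs"
    and succ: "successively (\<lambda>a b. (a, b) \<in> parcs T) xs" and "(w, hd xs) \<in> parcs T" "(last xs, w) \<in> parcs T"
  shows "\<exists>p. simple_cycle T p"
proof -
  interpret pair_wf_digraph T by fact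
  let ?ys = "w # xs @ [w]"
  have "xs \<noteq> []" using assms by auto
  then have "successively (\<lambda>a b. (a, b) \<in> parcs T) ?ys"
    using assms by (auto simp: successively_Cons successively_append_iff)
  then have "awalk w (zip ?ys (tl ?ys)) w"
    using pcas_zip_tl[of ?ys] successively_zip_tl[of "parcs T" ?ys] assms(6)
    by (auto simp: awalk_def dest: wellformed')
  moreover have "pawalk_verts w (zip ?ys (tl ?ys)) = ?ys"
    using pawalk_verts_zip_tl[of ?ys] by simp
  then have "distinct (tl (pawalk_verts w (zip ?ys (tl ?ys))))"
    using assms by simp
  moreover have "3 \<le> length (zip ?ys (tl ?ys))" using assms by simp
  ultimately show ?thesis
    unfolding simple_cycle_def cycle_def by (intro exI[of _ "zip ?ys (tl ?ys)"]) auto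
qed

text \<open>
  \<open>par\<close> is a parent function on \<open>S\<close> with root \<open>s\<close>. The injective labelling \<open>d\<close> takes the place of the
  depth: it decreases towards the root and also separates siblings.
\<close>

definition rooted_part :: "'a pair_pre_digraph \<Rightarrow> 'a \<Rightarrow> 'a set \<Rightarrow> ('a \<Rightarrow> nat) \<Rightarrow> ('a \<Rightarrow> 'a) \<Rightarrow> bool" where
  "rooted_part T s S d par \<longleftrightarrow> S \<subseteq> pverts T \<and> s \<in> S \<and> inj_on d S \<and>
    (\<forall>v \<in> S - {s}. par v \<in> S \<and> d (par v) < d v) \<and>
    (\<forall>u \<in> S. \<forall>v \<in> S. (u, v) \<in> parcs T \<longleftrightarrow> u \<noteq> s \<and> v = par u \<or> v \<noteq> s \<and> u = par v)"

text \<open>A tree is connected, so some arc leads from \<open>S\<close> to a vertex outside; it has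
  no cycle, so that vertex has only one neighbour in \<open>S\<close>, which can serve as its
  parent.\<close>

lemma rooted_part_extend:
  assumes T: "tree_graph T" and rp: "rooted_part T s S d par" and ne: "S \<noteq> pverts T"
  shows "\<exists>w d' par'. w \<notin> S \<and> rooted_part T s (insert w S) d' par'"
proof -
  interpret pair_graph T using T by (simp add: tree_graph_def)
  have S: "S \<subseteq> pverts T" "s \<in> S" "inj_on d S"
    and par: "\<And>v. v \<in> S \<Longrightarrow> v \<noteq> s \<Longrightarrow> par v \<in> S \<and> d (par v) < d v"
    and arcs: "\<And>u v. u \<in> S \<Longrightarrow> v \<in> S \<Longrightarrow> (u, v) \<in> parcs T \<longleftrightarrow> u \<noteq> s \<and> v = par u \<or> v \<noteq> s \<and> u = par v"
    using rp unfolding rooted_part_def by auto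
  have finS: "finite S" using S pair_finite_verts finite_subset by blast
  have sym: "(u, v) \<in> parcs T \<Longrightarrow> (v, u) \<in> parcs T" for u v
    using pair_sym_arcs by (auto simp: symmetric_def sym_def)
  obtain x where x: "x \<in> pverts T" "x \<notin> S" using ne S by auto
  have "(s, x) \<in> rtrancl_on (pverts T) ((parcs T)\<^sup>s)"
    using T x S unfolding tree_graph_def connected_conv by auto
  \<comment> \<open>A walk from \<open>s\<close> either stays in \<open>S\<close> or has a first arc
    leaving it.\<close>
  then have "x \<in> S \<or> (\<exists>u\<in>S. \<exists>w\<in>pverts T - S. (u, w) \<in> parcs T)"
  proof (induction rule: rtrancl_on_induct)
    case (step y z)
    then show ?case using sym by (auto simp: symcl_def)
  qed (use S in simp)
  then obtain u w where uw: "u \<in> S" "w \<in> pverts T" "w \<notin> S" "(u, w) \<in> parcs T" using x by blast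
  \<comment> \<open>Restricting the arcs to \<open>S\<close> ensures that the path found between two
    neighbours of \<open>w\<close> avoids \<open>w\<close>.\<close>
  define R where "R = parcs T \<inter> S \<times> S"
  have to_s: "(v, s) \<in> R\<^sup>*" if "v \<in> S" for v
    using that
  proof (induction "d v" arbitrary: v rule: less_induct)
    case less
    show ?case
    proof (cases "v = s")
      case False
      with par[OF less.prems] arcs[of v "par v"] less.prems have "(v, par v) \<in> R" by (auto simp: R_def)
      with less False par show ?thesis by (meson converse_rtrancl_into_rtrancl)
    qed simp
  qed
  have "sym (R\<^sup>*)" using sym by (intro sym_rtrancl) (auto simp: R_def sym_def)
  then have conn: "(v, v') \<in> R\<^sup>*" if "v \<in> S" "v' \<in> S" for v v'
    using to_s[OF that(1)] to_s[OF that(2)] by (meson rtrancl_trans symD)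
  \<comment> \<open>A second neighbour of \<open>w\<close> in the connected part \<open>S\<close> would close a cycle through \<open>w\<close>.\<close>
  have unique: "v = u" if "v \<in> S" "(v, w) \<in> parcs T" for v
  proof (rule ccontr)
    assume "v \<noteq> u"
    obtain xs where xs: "xs \<noteq> []" "hd xs = v" "last xs = u" "distinct xs" "set xs \<subseteq> insert u (Domain R)"
      "successively (\<lambda>a b. (a, b) \<in> R) xs"
      using rtrancl_imp_distinct_path[OF conn[OF \<open>v \<in> S\<close> \<open>u \<in> S\<close>]] by blast
    have "2 \<le> length xs" using xs \<open>v \<noteq> u\<close> by (cases xs rule: remdups_adj.cases) auto
    moreover have "w \<notin> set xs" using xs uw by (auto simp: R_def)
    moreover have "successively (\<lambda>a b. (a, b) \<in> parcs T) xs"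
      by (rule successively_mono[OF xs(6)]) (auto simp: R_def)
    ultimately have "\<exists>p. simple_cycle T p"
      using xs uw that sym[OF that(2)] by (intro simple_cycle_through[of T xs w]) (auto intro: pair_wf_digraph)
    then show False using T by (simp add: tree_graph_def)
  qed
  \<comment> \<open>A label above all old ones keeps \<open>d'\<close> injective and makes it
    decrease from \<open>w\<close> to its parent.\<close>
  define d' where "d' = d(w := Suc (Max (d ` S)))"
  define par' where "par' = par(w := u)"
  have less: "d v < Suc (Max (d ` S))" if "v \<in> S" for v
    using that finS by (simp add: less_Suc_eq_le)
  have d'S: "d' v = d v" "par' v = par v" if "v \<in> S" for v
    using that uw(3) by (auto simp: d'_def par'_def)
  have d'w: "d' w = Suc (Max (d ` S))" "par' w = u" by (simp_all add: d'_def par'_def)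
  have inj: "inj_on d' S"
    using S(3) d'S(1) by (simp add: inj_on_def)
  have notin: "d' w \<notin> d' ` S"
  proof
    assume "d' w \<in> d' ` S"
    then obtain v where "v \<in> S" "d' w = d' v" by blast
    then show False using less d'S d'w by (metis less_irrefl)
  qed
  have "rooted_part T s (insert w S) d' par'"
    unfolding rooted_part_def
  proof (intro conjI ballI)
    show "inj_on d' (insert w S)"
      using inj notin uw(3) by (simp add: inj_on_insert)
    show "par' v \<in> insert w S" "d' (par' v) < d' v" if "v \<in> insert w S - {s}" for v
      using that par[of v] uw(1) less[of u] by (auto simp: d'S d'w)
    show "(a, b) \<in> parcs T \<longleftrightarrow> a \<noteq> s \<and> b = par' a \<or> b \<noteq> s \<and> a = par' b"
      if ab: "a \<in> insert w S" "b \<in> insert w S" for a b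
    proof -
      consider "a \<in> S" "b \<in> S" | "a = w" "b \<in> S" | "a \<in> S" "b = w" | "a = w" "b = w" using ab by blast
      then show ?thesis
      proof cases
        case 1
        then show ?thesis using arcs by (simp add: d'S)
      next
        case 2
        have "par b \<noteq> w" if "b \<noteq> s" using par[of b] uw that 2 by auto
        moreover have "(w, b) \<in> parcs T \<longleftrightarrow> b = u" using unique[OF 2(2)] sym uw by blast
        moreover have "w \<noteq> s" using S uw by blast
        ultimately show ?thesis using 2 by (auto simp: d'S d'w)
      next
        case 3
        have "par a \<noteq> w" if "a \<noteq> s" using par[of a] uw that 3 by auto
        moreover have "(a, w) \<in> parcs T \<longleftrightarrow> a = u" using unique[OF 3(1)] uw by blast
        moreover have "w \<noteq> s" using S uw by blast
        ultimately show ?thesis using 3 by (auto simp: d'S d'w)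
      next
        case 4
        then show ?thesis using pair_no_loops[of "(w, w)"] uw by (auto simp: d'w)
      qed
    qed
  qed (use S uw in auto)
  then show ?thesis using uw(3) by blast
qed

text \<open>Starting from \<open>{s}\<close>, vertices are added one at a time until the part has as
  many vertices as \<open>T\<close>; being a subset, it is then all of \<open>T\<close>.\<close>

lemma tree_graph_rooted:
  assumes T: "tree_graph T" and s: "s \<in> pverts T"
  shows "\<exists>d par. rooted_part T s (pverts T) d par"
proof -
  interpret pair_graph T using T by (simp add: tree_graph_def)
  have "\<exists>S d par. rooted_part T s S d par \<and> card S = Suc k" if "k < card (pverts T)" for k
    using that
  proof (induction k)
    case 0
    have "rooted_part T s {s} (\<lambda>_. 0) id"
      using s pair_no_loops[of "(s, s)"] by (auto simp: rooted_part_def)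
    then show ?case by fastforce
  next
    case (Suc k)
    then obtain S d par where *: "rooted_part T s S d par" "card S = Suc k" by auto
    then have "S \<noteq> pverts T" using Suc.prems by auto
    with * obtain w d' par' where "w \<notin> S" "rooted_part T s (insert w S) d' par'"
      using rooted_part_extend[OF T] by blast
    moreover have "finite S" using * card.infinite by fastforce
    ultimately show ?case using * by (intro exI[of _ "insert w S"] exI[of _ d'] exI[of _ par']) simp
  qed
  from this[of "card (pverts T) - 1"] obtain S d par where *: "rooted_part T s S d par" "card S = card (pverts T)"
    using s pair_finite_verts card_gt_0_iff by (metis Suc_pred' diff_less empty_iff zero_less_one)
  then have "S = pverts T"
    using pair_finite_verts card_subset_eq unfolding rooted_part_def by blast
  with * show ?thesis by blast
qed

text \<open>The start \<open>s\<close> of the closed walk is kept apart from the other vertices,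
  listed in cyclic order in \<open>ls\<close>: it will be the root of the tree and its path will
  close the row of leaves.\<close>

lemma cycle_graph_list:
  assumes "cycle_graph C"
  obtains s ls where "pverts C = insert s (set ls)" "s \<notin> set ls" "distinct ls" "2 \<le> length ls"
    "parcs C = set (zip (s # ls) (ls @ [s])) \<union> (set (zip (s # ls) (ls @ [s])))\<inverse>"
proof -
  from assms obtain p where C: "pair_graph C" and p: "simple_cycle C p" "pverts C = fst ` set p"
    "parcs C = set p \<union> (set p)\<inverse>"
    unfolding cycle_graph_def by blast
  interpret pair_graph C by fact
  from p obtain s where s: "pcas s p s" "distinct (tl (pawalk_verts s p))" "3 \<le> length p"
    unfolding simple_cycle_def cycle_def awalk_def by auto
  \<comment> \<open>The heads of the arcs are the vertices after the start, the last being
    \<open>s\<close> again; \<open>butlast\<close> removes this return.\<close>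
  define ls where "ls = butlast (map snd p)"
  have zip: "p = zip (s # map snd p) (map snd p)" and last: "last (s # map snd p) = s"
    using pcas_eq_zip[OF s(1)] by auto
  have "p \<noteq> []" using s by auto
  then have snd: "map snd p = ls @ [s]"
    using last append_butlast_last_id[of "map snd p"] by (simp add: ls_def)
  have len: "length p = Suc (length ls)" using arg_cong[OF snd, of length] by simp
  have pz: "p = zip (s # ls) (ls @ [s])"
    using zip unfolding snd by (simp add: zip_append1 zip_append2 flip: append_Cons)
  have "tl (pawalk_verts s p) = ls @ [s]"
    using pcas_eq_zip(3)[OF s(1)] snd by simp
  show ?thesis
  proof
    show "s \<notin> set ls" "distinct ls" using s(2) \<open>tl (pawalk_verts s p) = ls @ [s]\<close> by auto
    show "2 \<le> length ls" using s(3) len by simp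
    have "map fst p = s # ls" by (subst pz) simp
    then show "pverts C = insert s (set ls)" using p(2) by (metis list.simps(15) set_map)
    show "parcs C = set (zip (s # ls) (ls @ [s])) \<union> (set (zip (s # ls) (ls @ [s])))\<inverse>"
      using p(3) pz by simp
  qed
qed

section \<open>Two bends suffice\<close>

text \<open>With integer coordinates, distinct columns differ by at least one, so unit segments of a
  line that start in distinct columns never overlap.\<close>

definition int_grid :: "(int \<times> int \<times> int) set \<Rightarrow> (real \<times> real \<times> real) set" where
  "int_grid A = (\<lambda>(c, l, r). (of_int c, of_int l, of_int r)) ` A"

definition int_overlap :: "(int \<times> int \<times> int) set \<Rightarrow> (int \<times> int \<times> int) set \<Rightarrow> bool" where
  "int_overlap A B \<longleftrightarrow> (\<exists>(c, l, r) \<in> A. \<exists>(c', l', r') \<in> B. c = c' \<and> max l l' < min r r')"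

lemma overlap_int_grid: "overlap (int_grid A) (int_grid B) \<longleftrightarrow> int_overlap A B"
  unfolding overlap_def int_grid_def int_overlap_def
  by (simp add: split_beta flip: of_int_max of_int_min)

lemma int_overlap_commute: "int_overlap A B \<longleftrightarrow> int_overlap B A"
proof -
  have "int_overlap B A" if "int_overlap A B" for A B
  proof -
    from that obtain c l r l' r' where "(c, l, r) \<in> A" "(c, l', r') \<in> B" "max l l' < min r r'"
      unfolding int_overlap_def by auto
    then show ?thesis
      unfolding int_overlap_def by (intro bexI[of _ "(c, l', r')"]) (auto intro!: bexI[of _ "(c, l, r)"])
  qed
  then show ?thesis by blast
qed

text \<open>Unrolls enumerated sets into plain comparisons. The last rule asks for two elements on
  the left, so it does not apply to the singletons that it produces.\<close>

lemma int_overlap_simps [simp]: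
  "\<not> int_overlap {} B" "\<not> int_overlap A {}"
  "int_overlap {(c, l, r)} (insert (c', l', r') B) \<longleftrightarrow>
    c = c' \<and> l < r \<and> l < r' \<and> l' < r \<and> l' < r' \<or> int_overlap {(c, l, r)} B"
  "int_overlap (insert (c, l, r) (insert x A)) B \<longleftrightarrow>
    int_overlap {(c, l, r)} B \<or> int_overlap (insert x A) B"
  by (auto simp: int_overlap_def)

lemma EPG_graph_if_int_grid:
  assumes "pair_graph G"
    and path: "\<And>u. u \<in> pverts G \<Longrightarrow> bend_path k (P u) \<and> path_image (P u) = grid_set (int_grid (H u)) (int_grid (V u))
      \<and> finite (H u) \<and> finite (V u)"
    and adj: "\<And>u v. u \<in> pverts G \<Longrightarrow> v \<in> pverts G \<Longrightarrow> u \<noteq> v \<Longrightarrow>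
      (u, v) \<in> parcs G \<longleftrightarrow> int_overlap (H u) (H v) \<or> int_overlap (V u) (V v)"
  shows "EPG_graph k G"
proof -
  have "EPG_representation k G P"
    unfolding EPG_representation_def
  proof (intro conjI ballI impI)
    fix u v assume uv: "u \<in> pverts G" "v \<in> pverts G" "u \<noteq> v"
    have "share_segment (P u) (P v) \<longleftrightarrow>
        overlap (int_grid (H u)) (int_grid (H v)) \<or> overlap (int_grid (V u)) (int_grid (V v))"
      by (rule share_segment_grid) (use path uv in \<open>auto simp: int_grid_def\<close>)
    then show "(u, v) \<in> parcs G \<longleftrightarrow> share_segment (P u) (P v)"
      using adj[OF uv] by (simp add: overlap_int_grid)
  qed (use path in blast)
  then show ?thesis using assms(1) by (auto simp: EPG_graph_def)
qed

text \<open>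
  Every inner vertex \<open>v\<close> owns the grid line \<open>y = d v\<close>. The \<open>i\<close>-th leaf is a U whose bottom lies on the line of
  its parent, between the columns \<open>i\<close> and \<open>i + 1\<close>; consecutive leaves meet in the column between them.
  To the right of the leaves, a vertex \<open>v\<close> descends in its own column \<open>Z v\<close> to the line of its parent.
  The last leaf \<open>s\<close> closes the cycle above everything else, and the root, which has no parent to meet,
  spends its two bends on reaching \<open>s\<close> from the left.
\<close>

lemma EPG_graph_2_rooted_tree_union_cycle:
  fixes G :: "'a pair_pre_digraph" and d :: "'a \<Rightarrow> nat"
  assumes G: "pair_graph G"
    and verts: "pverts G = I \<union> set ls \<union> {s}" "I \<inter> set ls = {}" "s \<notin> I" "s \<notin> set ls"
    and ls: "distinct ls" "2 \<le> length ls"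
    and r: "r \<in> I" and d: "inj_on d I"
    and par_leaf: "\<And>i. i < length ls \<Longrightarrow> par (ls ! i) \<in> I"
    and par: "\<And>v. v \<in> I \<Longrightarrow> v \<noteq> r \<Longrightarrow> par v \<in> I \<and> d (par v) < d v"
    and arc_ls: "\<And>i j. i < length ls \<Longrightarrow> j < length ls \<Longrightarrow> (ls ! i, ls ! j) \<in> parcs G \<longleftrightarrow> j = Suc i \<or> i = Suc j"
    and arc_ls_s: "\<And>i. i < length ls \<Longrightarrow> (ls ! i, s) \<in> parcs G \<longleftrightarrow> i = 0 \<or> Suc i = length ls"
    and arc_ls_I: "\<And>i v. i < length ls \<Longrightarrow> v \<in> I \<Longrightarrow> (ls ! i, v) \<in> parcs G \<longleftrightarrow> v = par (ls ! i)"
    and arc_s_I: "\<And>v. v \<in> I \<Longrightarrow> (s, v) \<in> parcs G \<longleftrightarrow> v = r"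
    and arc_I: "\<And>u v. u \<in> I \<Longrightarrow> v \<in> I \<Longrightarrow> u \<noteq> v \<Longrightarrow>
      (u, v) \<in> parcs G \<longleftrightarrow> u \<noteq> r \<and> v = par u \<or> v \<noteq> r \<and> u = par v"
  shows "EPG_graph 2 G"
proof -
  interpret pair_graph G by fact
  have "finite I" using pair_finite_verts verts(1) by auto
  then obtain N where N: "\<And>v. v \<in> I \<Longrightarrow> d v < N"
    by (metis finite_imageI finite_nat_set_iff_bounded imageI)
  define n where "n = int (length ls)"
  \<comment> \<open>All lines of inner vertices lie below height \<open>b\<close>, which leaves the
    heights from \<open>b\<close> to \<open>b + 2\<close> for closing the cycle.\<close>
  define b where "b = int N"
  define y where "y v = int (d v)" for v
  \<comment> \<open>The smaller the label, the further right the column. Hence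
    \<open>Z v + 1\<close> is at most \<open>Z (par v)\<close>, and the last unit of the path of
    \<open>v\<close> lies on its parent's line; siblings have distinct labels and use different
    units.\<close>
  define Z where "Z v = n + 1 + b - y v" for v
  have n: "n \<ge> 2" using ls by (simp add: n_def)
  have y: "0 \<le> y v" "y v < b" if "v \<in> I" for v using N[OF that] by (auto simp: y_def b_def)
  have Z: "n + 1 < Z v" if "v \<in> I" for v using y[OF that] by (simp add: Z_def)
  have y_inj: "y u = y v \<longleftrightarrow> u = v" if "u \<in> I" "v \<in> I" for u v
    using inj_on_eq_iff[OF d that] by (simp add: y_def)
  have y_par: "par v \<in> I" "y (par v) < y v" if "v \<in> I" "v \<noteq> r" for v
    using par[OF that] by (auto simp: y_def)
  define idx where "idx v = (SOME i. i < length ls \<and> ls ! i = v)" for v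
  have idx: "idx (ls ! i) = i" if "i < length ls" for i
    unfolding idx_def by (rule some_equality) (use that ls nth_eq_iff_index_eq in auto)
  define path :: "int list \<Rightarrow> real \<Rightarrow> complex" where
    "path = (\<lambda>[x1, y1, x2, y2, x3, y3, x4, y4] \<Rightarrow>
      polyline [Complex x1 y1, Complex x2 y2, Complex x3 y3, Complex x4 y4])"
  \<comment> \<open>The leaves in \<open>ls\<close> end at \<open>b + 1\<close> and the ends of
    \<open>s\<close> reach down to \<open>b\<close>, so \<open>s\<close> shares one unit of column
    \<open>0\<close> with the first of them and one unit of column \<open>n\<close> with the last.
    Column \<open>-1\<close> belongs to the root alone, and height \<open>b + 2\<close> to the root
    and \<open>s\<close> alone.\<close>
  define P where "P v =
    (if v = s then path [0, b, 0, b + 2, n, b + 2, n, b]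
     else if v = r then path [Z v, y v, - 1, y v, - 1, b + 2, n, b + 2]
     else if v \<in> I then path [0, y v, Z v, y v, Z v, y (par v), Z v + 1, y (par v)]
     else path [int (idx v), b + 1, int (idx v), y (par v), int (idx v) + 1, y (par v), int (idx v) + 1, b + 1])" for v
  define H where "H v =
    (if v = s then {(b + 2, 0, n)}
     else if v = r then {(y v, - 1, Z v), (b + 2, - 1, n)}
     else if v \<in> I then {(y v, 0, Z v), (y (par v), Z v, Z v + 1)}
     else {(y (par v), int (idx v), int (idx v) + 1)})" for v
  define V where "V v =
    (if v = s then {(0, b, b + 2), (n, b, b + 2)}
     else if v = r then {(- 1, y v, b + 2)}
     else if v \<in> I then {(Z v, y (par v), y v)}
     else {(int (idx v), y (par v), b + 1), (int (idx v) + 1, y (par v), b + 1)})" for v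
  have s: "P s = path [0, b, 0, b + 2, n, b + 2, n, b]" "H s = {(b + 2, 0, n)}" "V s = {(0, b, b + 2), (n, b, b + 2)}"
    by (simp_all add: P_def H_def V_def)
  have root: "P r = path [Z r, y r, - 1, y r, - 1, b + 2, n, b + 2]"
      "H r = {(y r, - 1, Z r), (b + 2, - 1, n)}" "V r = {(- 1, y r, b + 2)}"
    using r verts by (auto simp: P_def H_def V_def)
  have inner: "P v = path [0, y v, Z v, y v, Z v, y (par v), Z v + 1, y (par v)]"
      "H v = {(y v, 0, Z v), (y (par v), Z v, Z v + 1)}" "V v = {(Z v, y (par v), y v)}" if "v \<in> I" "v \<noteq> r" for v
    using that verts by (auto simp: P_def H_def V_def)
  have leaf: "P (ls ! i) = path [int i, b + 1, int i, y (par (ls ! i)), int i + 1, y (par (ls ! i)), int i + 1, b + 1]"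
      "H (ls ! i) = {(y (par (ls ! i)), int i, int i + 1)}"
      "V (ls ! i) = {(int i, y (par (ls ! i)), b + 1), (int i + 1, y (par (ls ! i)), b + 1)}" if "i < length ls" for i
  proof -
    have "ls ! i \<noteq> s" "ls ! i \<noteq> r" "ls ! i \<notin> I" using that verts r nth_mem[OF that] by auto
    then show "P (ls ! i) = path [int i, b + 1, int i, y (par (ls ! i)), int i + 1, y (par (ls ! i)), int i + 1, b + 1]"
      "H (ls ! i) = {(y (par (ls ! i)), int i, int i + 1)}"
      "V (ls ! i) = {(int i, y (par (ls ! i)), b + 1), (int i + 1, y (par (ls ! i)), b + 1)}"
      by (simp_all add: P_def H_def V_def idx[OF that])
  qed
  note y_leaf = y[OF par_leaf]
  have verts_cases: Q if "v \<in> pverts G" "v = s \<Longrightarrow> Q" "v = r \<Longrightarrow> Q" "v \<in> I \<Longrightarrow> v \<noteq> r \<Longrightarrow> Q"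
    "\<And>i. v = ls ! i \<Longrightarrow> i < length ls \<Longrightarrow> Q" for v Q
  proof -
    have "v = s \<or> v = r \<or> v \<in> I \<and> v \<noteq> r \<or> (\<exists>i<length ls. v = ls ! i)"
      using that(1) unfolding verts(1) by (auto simp: in_set_conv_nth)
    then show Q using that(2-) by blast
  qed
  have hvh: "bend_path 2 (path [a, z, x, z, x, z', c, z']) \<and>
      path_image (path [a, z, x, z, x, z', c, z']) =
        grid_set (int_grid {(z, min a x, max a x), (z', min x c, max x c)}) (int_grid {(x, min z z', max z z')})"
    if "a \<noteq> x" "z \<noteq> z'" "x \<noteq> c" for a x z z' c :: int
    using hvh_path[of a x z z' c] that by (simp add: path_def int_grid_def of_int_min of_int_max)
  have vhv: "bend_path 2 (path [x, a, x, z, x', z, x', c]) \<and>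
      path_image (path [x, a, x, z, x', z, x', c]) =
        grid_set (int_grid {(z, min x x', max x x')}) (int_grid {(x, min a z, max a z), (x', min z c, max z c)})"
    if "a \<noteq> z" "x \<noteq> x'" "z \<noteq> c" for a x x' z c :: int
    using vhv_path[of a z x x' c] that by (simp add: path_def int_grid_def of_int_min of_int_max)
  have sym: "(u, v) \<in> parcs G \<longleftrightarrow> (v, u) \<in> parcs G" for u v
    using pair_sym_arcs by (auto simp: symmetric_def sym_def)
  \<comment> \<open>As \<open>A\<close> is symmetric, eight pairs of kinds suffice among leaves in
    \<open>ls\<close>, \<open>s\<close>, the root and other inner vertices.\<close>
  define A where "A u v \<longleftrightarrow> ((u, v) \<in> parcs G \<longleftrightarrow> int_overlap (H u) (H v) \<or> int_overlap (V u) (V v))" for u v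
  have A_sym: "A u v" if "A v u" for u v
    using that sym int_overlap_commute unfolding A_def by metis
  \<comment> \<open>Leaves with a common parent use different units of its line, so only a common
    column makes them adjacent.\<close>
  have A_ll: "A (ls ! i) (ls ! j)" if "i < length ls" "j < length ls" "i \<noteq> j" for i j
  proof -
    have "int_overlap (H (ls ! i)) (H (ls ! j)) \<or> int_overlap (V (ls ! i)) (V (ls ! j)) \<longleftrightarrow>
        int j = int i + 1 \<or> int i = int j + 1"
      using y_leaf(2)[OF that(1)] y_leaf(2)[OF that(2)] that(3) unfolding leaf[OF that(1)] leaf[OF that(2)] by auto
    then show ?thesis unfolding A_def arc_ls[OF that(1,2)] by linarith
  qed
  have A_ls: "A (ls ! i) s" if "i < length ls" for i
  proof -
    have "int_overlap (H (ls ! i)) (H s) \<or> int_overlap (V (ls ! i)) (V s) \<longleftrightarrow> int i = 0 \<or> int i + 1 = n"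
      using y_leaf(2)[OF that] n that unfolding leaf[OF that] s n_def by auto
    then show ?thesis unfolding A_def arc_ls_s[OF that] n_def by linarith
  qed
  \<comment> \<open>The column of \<open>v\<close> and its unit on the parent's line lie beyond
    \<open>n + 1\<close>, clear of the leaves; only the line of \<open>v\<close> itself can meet a
    leaf.\<close>
  have A_lv: "A (ls ! i) v" if "i < length ls" "v \<in> I" "v \<noteq> r" for i v
  proof -
    have "int_overlap (H (ls ! i)) (H v) \<or> int_overlap (V (ls ! i)) (V v) \<longleftrightarrow> y (par (ls ! i)) = y v"
      using y_leaf(2)[OF that(1)] that(1) Z[OF that(2)] unfolding leaf[OF that(1)] inner[OF that(2,3)] n_def by auto
    then show ?thesis unfolding A_def arc_ls_I[OF that(1,2)] using y_inj[OF par_leaf[OF that(1)] that(2)] by auto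
  qed
  have A_lr: "A (ls ! i) r" if "i < length ls" for i
  proof -
    have "int_overlap (H (ls ! i)) (H r) \<or> int_overlap (V (ls ! i)) (V r) \<longleftrightarrow> y (par (ls ! i)) = y r"
      using y_leaf(2)[OF that(1)] that(1) Z[OF r] unfolding leaf[OF that(1)] root n_def by auto
    then show ?thesis unfolding A_def arc_ls_I[OF that(1) r] using y_inj[OF par_leaf[OF that(1)] r] by auto
  qed
  have A_sv: "A s v" if "v \<in> I" "v \<noteq> r" for v
    using n that y(2)[OF y_par(1)[OF that]] y(2)[OF that(1)] Z[OF that(1)]
    unfolding A_def arc_s_I[OF that(1)] s inner[OF that] by auto
  have A_sr: "A s r"
    using n unfolding A_def arc_s_I[OF r] s root by auto
  have A_vr: "A v r" if "v \<in> I" "v \<noteq> r" for v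
  proof -
    have "y v \<noteq> y r" using y_inj[OF that(1) r] that by simp
    then have "int_overlap (H v) (H r) \<or> int_overlap (V v) (V r) \<longleftrightarrow> y (par v) = y r"
      using n y(2)[OF y_par(1)[OF that]] y(2)[OF that(1)] y_par(2)[OF that] Z[OF that(1)] Z[OF r]
        Z_def[of v] Z_def[of r] unfolding inner[OF that] root by auto
    then show ?thesis
      unfolding A_def arc_I[OF that(1) r that(2)] using y_inj[OF y_par(1)[OF that] r] that by auto
  qed
  have A_uv: "A u v" if "u \<in> I" "u \<noteq> r" "v \<in> I" "v \<noteq> r" "u \<noteq> v" for u v
  proof -
    have "y u \<noteq> y v" using y_inj[OF that(1,3)] that by simp
    then have "int_overlap (H u) (H v) \<or> int_overlap (V u) (V v) \<longleftrightarrow> y (par u) = y v \<or> y (par v) = y u"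
      using n y_par(2)[OF that(1,2)] y_par(2)[OF that(3,4)] Z[OF that(1)] Z[OF that(3)]
        Z_def[of u] Z_def[of v] unfolding inner[OF that(1,2)] inner[OF that(3,4)] by auto
    then show ?thesis
      unfolding A_def arc_I[OF that(1,3,5)]
      using y_inj[OF y_par(1)[OF that(1,2)] that(3)] y_inj[OF y_par(1)[OF that(3,4)] that(1)] that by auto
  qed
  show ?thesis
  proof (rule EPG_graph_if_int_grid[OF G, where P = P and H = H and V = V])
    show "bend_path 2 (P u) \<and> path_image (P u) = grid_set (int_grid (H u)) (int_grid (V u))
      \<and> finite (H u) \<and> finite (V u)" if "u \<in> pverts G" for u
      using that
    proof (rule verts_cases)
      assume "u = s"
      then show ?thesis
        using vhv[of b "b + 2" 0 n b] n by (simp add: s)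
    next
      assume "u = r"
      then show ?thesis
        using hvh[of "Z r" "- 1" "y r" "b + 2" n] n Z[OF r] y[OF r] by (simp add: root min_def max_def)
    next
      assume u: "u \<in> I" "u \<noteq> r"
      then show ?thesis
        using hvh[of 0 "Z u" "y u" "y (par u)" "Z u + 1"] n Z[OF u(1)] y[OF u(1)] y_par[OF u]
        by (simp add: inner min_def max_def)
    next
      fix i assume i: "u = ls ! i" "i < length ls"
      then show ?thesis
        using vhv[of "b + 1" "y (par (ls ! i))" "int i" "int i + 1" "b + 1"] y_leaf[OF i(2)]
        by (simp add: leaf min_def max_def)
    qed
  next
    have "A u v" if "u \<in> pverts G" "v \<in> pverts G" "u \<noteq> v" for u v
      by (rule verts_cases[OF that(1)]; rule verts_cases[OF that(2)]; insert that(3))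
        (auto intro: A_ll A_ls A_lv A_lr A_sv A_sr A_vr A_uv intro: A_sym[OF A_ls] A_sym[OF A_lv] A_sym[OF A_lr]
          A_sym[OF A_sv] A_sym[OF A_sr] A_sym[OF A_vr])
    then show "(u, v) \<in> parcs G \<longleftrightarrow> int_overlap (H u) (H v) \<or> int_overlap (V u) (V v)"
      if "u \<in> pverts G" "v \<in> pverts G" "u \<noteq> v" for u v
      using that unfolding A_def by blast
  qed
qed

text \<open>With \<open>T\<close> rooted at the leaf \<open>s\<close>, the only neighbour
  \<open>r\<close> of \<open>s\<close> is the root of the inner vertices. Every other leaf has no
  children, so its only tree neighbour is its parent, which is inner.\<close>

lemma tree_union_cycle_graph_EPG_2:
  assumes "tree_union_cycle_graph G"
  shows "EPG_graph 2 G"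
proof -
  from assms obtain T C where G: "pair_graph G" and T: "tree_graph T" and C: "cycle_graph C"
    and leaves: "pverts C = leaves T"
    and G_eq: "G = \<lparr>pverts = pverts T \<union> pverts C, parcs = parcs T \<union> parcs C\<rparr>"
    unfolding tree_union_cycle_graph_def by blast
  interpret T: pair_graph T using T by (simp add: tree_graph_def)
  obtain s ls where ls: "pverts C = insert s (set ls)" "s \<notin> set ls" "distinct ls" "2 \<le> length ls"
    and C_arcs: "parcs C = set (zip (s # ls) (ls @ [s])) \<union> (set (zip (s # ls) (ls @ [s])))\<inverse>"
    using cycle_graph_list[OF C] by blast
  define E where "E = parcs T"
  define n where "n = length ls"
  define I where "I = pverts T - leaves T"
  have leavesI: "leaves T = insert s (set ls)" using ls leaves by simp
  have sT: "s \<in> pverts T" using leavesI by (auto simp: leaves_def)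
  obtain d par0 where rp: "rooted_part T s (pverts T) d par0" using tree_graph_rooted[OF T sT] by blast
  have d: "inj_on d (pverts T)"
    and par0: "\<And>v. v \<in> pverts T \<Longrightarrow> v \<noteq> s \<Longrightarrow> par0 v \<in> pverts T \<and> d (par0 v) < d v"
    and E: "\<And>u v. u \<in> pverts T \<Longrightarrow> v \<in> pverts T \<Longrightarrow> (u, v) \<in> E \<longleftrightarrow> u \<noteq> s \<and> v = par0 u \<or> v \<noteq> s \<and> u = par0 v"
    using rp unfolding rooted_part_def E_def by auto
  have leaf_unique: "v = w" if "l \<in> leaves T" "(l, v) \<in> E" "(l, w) \<in> E" for l v w
  proof -
    have "card {w. (l, w) \<in> E} = 1" using that(1) by (simp add: leaves_def vertex_degree_eq E_def)
    then obtain x where "{w. (l, w) \<in> E} = {x}" by (auto simp: card_1_singleton_iff)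
    then have x: "u = x" if "(l, u) \<in> E" for u using that by (simp add: set_eq_iff)
    from x[OF that(2)] x[OF that(3)] show "v = w" by simp
  qed
  have par0_not_leaf: "l \<noteq> par0 v" if "l \<in> leaves T" "l \<noteq> s" "v \<in> pverts T" "v \<noteq> s" for l v
  proof
    assume l: "l = par0 v"
    have lT: "l \<in> pverts T" using that by (simp add: leaves_def)
    have "(l, v) \<in> E" "(l, par0 l) \<in> E" using E that l lT par0 by auto
    then have "v = par0 l" using leaf_unique that by blast
    then show False using par0[OF lT that(2)] par0[OF that(3,4)] l by auto
  qed
  have "s \<in> leaves T" using leavesI by simp
  then have "card {w. (s, w) \<in> E} = 1" by (simp add: leaves_def vertex_degree_eq E_def)
  then obtain r where r: "{w. (s, w) \<in> E} = {r}" by (auto simp: card_1_singleton_iff)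
  then have sr: "(s, w) \<in> E \<longleftrightarrow> w = r" for w by blast
  have rT: "r \<in> pverts T" "r \<noteq> s" using sr[of r] T.wellformed' T.pair_no_loops by (fastforce simp: E_def)+
  have par0_s: "par0 v = s \<longleftrightarrow> v = r" if "v \<in> pverts T" "v \<noteq> s" for v
    using E[OF sT that(1)] sr[of v] that by auto
  \<comment> \<open>If \<open>r\<close> were a leaf, neither \<open>s\<close> nor \<open>r\<close>
    could be the parent of a further vertex, and climbing from such a vertex would never end; but
    \<open>ls\<close> has at least two elements.\<close>
  have "r \<notin> leaves T"
  proof
    assume "r \<in> leaves T"
    have none: False if "v \<in> pverts T" "v \<noteq> s" "v \<noteq> r" for v
      using that
    proof (induction "d v" arbitrary: v rule: less_induct)
      case less
      have "par0 v \<noteq> s" "par0 v \<noteq> r"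
        using par0_s less.prems par0_not_leaf[OF \<open>r \<in> leaves T\<close> rT(2)] by auto
      then show False using less par0 by blast
    qed
    have "set ls \<noteq> {r}" using distinct_card[OF ls(3)] ls(4) by auto
    moreover have "set ls \<noteq> {}" using ls(4) by auto
    ultimately obtain v where "v \<in> set ls" "v \<noteq> r" by (metis equals0I singletonI subsetI subset_singletonD)
    then show False using none[of v] ls(2) leavesI by (auto simp: leaves_def)
  qed
  with rT have rI: "r \<in> I" by (simp add: I_def)
  \<comment> \<open>The edge between \<open>s\<close> and \<open>r\<close> is turned round, so that
    \<open>s\<close> hangs below the inner root \<open>r\<close> like any other leaf.\<close>
  define par where "par = par0(s := r)"
  have par: "par v \<in> I" "d (par v) < d v" if "v \<in> pverts T" "v \<noteq> s" "v \<noteq> r" for v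
  proof -
    have "par0 v \<noteq> s" using par0_s that by blast
    then have "par0 v \<notin> leaves T" using par0_not_leaf that by blast
    then show "par v \<in> I" "d (par v) < d v" using par0[OF that(1,2)] that by (auto simp: I_def par_def)
  qed
  have nth: "ls ! i \<in> leaves T" "ls ! i \<in> pverts T" "ls ! i \<noteq> s" "ls ! i \<noteq> r" "ls ! i \<notin> I" if "i < n" for i
  proof -
    have mem: "ls ! i \<in> set ls" using that by (simp add: n_def)
    then show leaf: "ls ! i \<in> leaves T" using leavesI by simp
    then show "ls ! i \<in> pverts T" by (simp add: leaves_def)
    show "ls ! i \<noteq> s" using mem ls(2) by metis
    show "ls ! i \<noteq> r" using leaf \<open>r \<notin> leaves T\<close> by metis
    show "ls ! i \<notin> I" using leaf by (simp add: I_def)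
  qed
  have I: "v \<in> pverts T" "v \<notin> leaves T" "v \<noteq> s" if "v \<in> I" for v
    using that leavesI by (simp_all add: I_def)
  have E_leaf: "(ls ! i, v) \<in> E \<longleftrightarrow> v = par (ls ! i)" if "i < n" "v \<in> pverts T" for i v
  proof -
    have "par (ls ! i) = par0 (ls ! i)" using nth(3)[OF that(1)] by (simp add: par_def)
    then show ?thesis
      using E[OF nth(2)[OF that(1)] that(2)] nth(3)[OF that(1)] par0_not_leaf[OF nth(1,3)[OF that(1)] that(2)]
      by metis
  qed
  \<comment> \<open>Arc 0 leaves \<open>s\<close> and arc \<open>n\<close> returns to it. The arc
    leaving \<open>ls ! i\<close> has index \<open>i + 1\<close>, the arc entering it has index
    \<open>i\<close>.\<close>
  have zip_nth: "(a, b) \<in> set (zip (s # ls) (ls @ [s])) \<longleftrightarrow> (\<exists>i\<le>n. a = (s # ls) ! i \<and> b = (ls @ [s]) ! i)" for a b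
    by (auto simp: set_zip n_def less_Suc_eq_le)
  have C_sub: "a \<in> leaves T \<and> b \<in> leaves T" if "(a, b) \<in> parcs C" for a b
  proof -
    have "a \<in> leaves T \<and> b \<in> leaves T" if "(a, b) \<in> set (zip (s # ls) (ls @ [s]))" for a b
      using set_zip_leftD[OF that] set_zip_rightD[OF that] unfolding leavesI by simp
    then show ?thesis using that unfolding C_arcs Un_iff converse_iff by blast
  qed
  have nth_inj: "ls ! i = ls ! j \<longleftrightarrow> i = j" if "i < n" "j < n" for i j
    using nth_eq_iff_index_eq[OF ls(3)] that by (simp add: n_def)
  have zip_ll: "(ls ! i, ls ! j) \<in> set (zip (s # ls) (ls @ [s])) \<longleftrightarrow> j = Suc i" if "i < n" "j < n" for i j
  proof
    assume "(ls ! i, ls ! j) \<in> set (zip (s # ls) (ls @ [s]))"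
    then obtain k where k: "k \<le> n" "ls ! i = (s # ls) ! k" "ls ! j = (ls @ [s]) ! k" unfolding zip_nth by blast
    then have "k \<noteq> 0" using nth[OF that(1)] by (auto intro: ccontr)
    then obtain k' where k': "k = Suc k'" using not0_implies_Suc by blast
    then have "i = k'" using k nth_inj[OF that(1), of k'] by simp
    moreover have "k < n" using k nth[OF that(2)] by (cases "k = n") (auto simp: n_def nth_append)
    then have "j = k" using k nth_inj[OF that(2), of k] by (simp add: n_def nth_append)
    ultimately show "j = Suc i" using k' by simp
  next
    assume "j = Suc i"
    then show "(ls ! i, ls ! j) \<in> set (zip (s # ls) (ls @ [s]))"
      unfolding zip_nth using that by (intro exI[of _ j]) (auto simp: n_def nth_append)
  qed
  have zip_ls: "(ls ! i, s) \<in> set (zip (s # ls) (ls @ [s])) \<longleftrightarrow> Suc i = n" if "i < n" for i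
  proof
    assume "(ls ! i, s) \<in> set (zip (s # ls) (ls @ [s]))"
    then obtain k where k: "k \<le> n" "ls ! i = (s # ls) ! k" "s = (ls @ [s]) ! k" unfolding zip_nth by blast
    have "k = n"
    proof (rule ccontr)
      assume "k \<noteq> n"
      then have "k < n" using k by simp
      then show False using k nth[of k] by (simp add: n_def nth_append)
    qed
    moreover have "k \<noteq> 0" using \<open>k = n\<close> that by simp
    then obtain k' where k': "k = Suc k'" using not0_implies_Suc by blast
    then have "i = k'" using k nth_inj[OF that(1), of k'] by simp
    ultimately show "Suc i = n" using k' by simp
  next
    assume "Suc i = n"
    then have "(s # ls) ! n = ls ! i" by auto
    then show "(ls ! i, s) \<in> set (zip (s # ls) (ls @ [s]))"
      unfolding zip_nth by (intro exI[of _ n]) (simp add: n_def)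
  qed
  have zip_sl: "(s, ls ! i) \<in> set (zip (s # ls) (ls @ [s])) \<longleftrightarrow> i = 0" if "i < n" for i
  proof
    assume "(s, ls ! i) \<in> set (zip (s # ls) (ls @ [s]))"
    then obtain k where k: "k \<le> n" "s = (s # ls) ! k" "ls ! i = (ls @ [s]) ! k" unfolding zip_nth by blast
    have "k = 0"
    proof (rule ccontr)
      assume "k \<noteq> 0"
      then obtain k' where "k = Suc k'" using not0_implies_Suc by blast
      then show False using k nth[of k'] by simp
    qed
    have "0 < n" using that by simp
    then show "i = 0" using k \<open>k = 0\<close> nth_inj[OF that(1), of 0] by (simp add: n_def nth_append)
  next
    assume "i = 0"
    then show "(s, ls ! i) \<in> set (zip (s # ls) (ls @ [s]))"
      unfolding zip_nth using that by (intro exI[of _ 0]) (auto simp: n_def nth_append)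
  qed
  have arcs: "(u, v) \<in> parcs G \<longleftrightarrow> (u, v) \<in> E \<or> (u, v) \<in> parcs C" for u v
    by (simp add: G_eq E_def)
  show ?thesis
  proof (rule EPG_graph_2_rooted_tree_union_cycle[OF G, where I = I and ls = ls and s = s and r = r and par = par and d = d])
    show "pverts G = I \<union> set ls \<union> {s}"
      using leavesI leaves by (auto simp: G_eq I_def leaves_def)
    show "I \<inter> set ls = {}" "s \<notin> I" "s \<notin> set ls" "distinct ls" "2 \<le> length ls" "r \<in> I"
      using leavesI ls rI by (auto simp: I_def)
    show "inj_on d I" using d by (rule inj_on_subset) (simp add: I_def)
    show "par (ls ! i) \<in> I" if "i < length ls" for i using par nth that by (simp add: n_def)
    show "par v \<in> I \<and> d (par v) < d v" if "v \<in> I" "v \<noteq> r" for v using par I that by blast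
    show "(ls ! i, ls ! j) \<in> parcs G \<longleftrightarrow> j = Suc i \<or> i = Suc j" if "i < length ls" "j < length ls" for i j
    proof -
      have ij: "i < n" "j < n" using that by (auto simp: n_def)
      \<comment> \<open>Parents are inner, so no tree edge joins two leaves.\<close>
      have "(ls ! i, ls ! j) \<notin> E"
        using E_leaf[OF ij(1) nth(2)[OF ij(2)]] par(1)[OF nth(2,3,4)[OF ij(1)]] nth(5)[OF ij(2)] by auto
      then show ?thesis unfolding arcs C_arcs using zip_ll[OF ij] zip_ll[OF ij(2,1)] by auto
    qed
    show "(ls ! i, s) \<in> parcs G \<longleftrightarrow> i = 0 \<or> Suc i = length ls" if "i < length ls" for i
    proof -
      have i: "i < n" using that by (simp add: n_def)
      have "(ls ! i, s) \<notin> E"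
        using E_leaf[OF i sT] par(1)[OF nth(2,3,4)[OF i]] I(3) by auto
      then show ?thesis unfolding arcs C_arcs using zip_ls[OF i] zip_sl[OF i] by (auto simp: n_def)
    qed
    show "(ls ! i, v) \<in> parcs G \<longleftrightarrow> v = par (ls ! i)" if "i < length ls" "v \<in> I" for i v
      using E_leaf[of i v] that(1) I[OF that(2)] C_sub[of "ls ! i" v] unfolding arcs n_def by blast
    show "(s, v) \<in> parcs G \<longleftrightarrow> v = r" if "v \<in> I" for v
      using sr[of v] I[OF that] C_sub[of s v] unfolding arcs by blast
    show "(u, v) \<in> parcs G \<longleftrightarrow> u \<noteq> r \<and> v = par u \<or> v \<noteq> r \<and> u = par v" if "u \<in> I" "v \<in> I" "u \<noteq> v" for u v
    proof -
      have "(u, v) \<in> parcs G \<longleftrightarrow> v = par0 u \<or> u = par0 v"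
        using E[OF I(1)[OF that(1)] I(1)[OF that(2)]] I[OF that(1)] I[OF that(2)] C_sub[of u v] unfolding arcs by blast
      moreover have "par0 r = s" using par0_s rT by blast
      ultimately show ?thesis using I(3)[OF that(1)] I(3)[OF that(2)] by (auto simp: par_def)
    qed
  qed
qed

section \<open>Paths with one bend around a corner\<close>

text \<open>The ends of a span come in either order, since a leg may point either way from its
  corner.\<close>

definition spans_overlap :: "real \<Rightarrow> real \<Rightarrow> real \<Rightarrow> real \<Rightarrow> bool" where
  "spans_overlap a b c d \<longleftrightarrow> max (min a b) (min c d) < min (max a b) (max c d)"

text \<open>
  A path with one bend is encoded as \<open>(x, y, h, k)\<close>: its corner is \<open>(x, y)\<close>, its horizontal segment ends in
  \<open>(h, y)\<close> and its vertical segment in \<open>(x, k)\<close>.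
\<close>

fun corner_adj :: "real \<times> real \<times> real \<times> real \<Rightarrow> real \<times> real \<times> real \<times> real \<Rightarrow> bool" where
  "corner_adj (x, y, h, k) (x', y', h', k') \<longleftrightarrow>
     y = y' \<and> spans_overlap x h x' h' \<or> x = x' \<and> spans_overlap y k y' k'"

fun proper_corner :: "real \<times> real \<times> real \<times> real \<Rightarrow> bool" where
  "proper_corner (x, y, h, k) \<longleftrightarrow> h \<noteq> x \<and> k \<noteq> y"

text \<open>Satisfied by every path that shares a segment with a path cornered at the origin and
  running right and up; how far the legs of that path extend is forgotten.\<close>

fun meets_axes :: "real \<times> real \<times> real \<times> real \<Rightarrow> bool" where
  "meets_axes (x, y, h, k) \<longleftrightarrow> y = 0 \<and> max x h > 0 \<or> x = 0 \<and> max y k > 0"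

text \<open>
  Unfold the two positive half-axes to a real line, the vertical one to the negative numbers.
  The part of the path on the half-axes becomes the interval from \<open>lo\<close> to \<open>hi\<close>
  (meaningful only if \<open>meets_axes\<close> holds).
\<close>

fun lo :: "real \<times> real \<times> real \<times> real \<Rightarrow> real" where
  "lo (x, y, h, k) = (if x = 0 \<and> max y k > 0 then - max y k else max 0 (min x h))"

fun hi :: "real \<times> real \<times> real \<times> real \<Rightarrow> real" where
  "hi (x, y, h, k) = (if y = 0 \<and> max x h > 0 then max x h else - max 0 (min y k))"

lemma lo_less_hi: "proper_corner p \<Longrightarrow> meets_axes p \<Longrightarrow> lo p < hi p"
  by (cases p) (auto simp: min_def max_def split: if_splits)

text \<open>Overlapping intervals cannot lie on opposite sides of 0, so both paths occupy part of a
  common half-axis, on which their spans then overlap.\<close>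

lemma corner_adj_if_unfolded_overlap:
  assumes "proper_corner p" "proper_corner q" "meets_axes p" "meets_axes q" "max (lo p) (lo q) < min (hi p) (hi q)"
  shows "corner_adj p q"
proof -
  obtain x y h k where p: "p = (x, y, h, k)" by (metis prod_cases4)
  obtain x' y' h' k' where q: "q = (x', y', h', k')" by (metis prod_cases4)
  have lt: "lo p < hi q" "lo q < hi p" using assms by auto
  note p' = assms(1,3)[unfolded p, simplified] and q' = assms(2,4)[unfolded q, simplified]
  consider "y = 0" "max x h > 0" "y' = 0" "max x' h' > 0" | "x = 0" "max y k > 0" "x' = 0" "max y' k' > 0"
    | "\<not> (x = 0 \<and> max y k > 0)" "\<not> (y' = 0 \<and> max x' h' > 0)"
    | "\<not> (x' = 0 \<and> max y' k' > 0)" "\<not> (y = 0 \<and> max x h > 0)"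
    using assms(3,4) unfolding p q meets_axes.simps by argo
  then show ?thesis
  proof cases
    case 1
    then have "min x h < max x' h'" "min x' h' < max x h"
      using lt p' q' unfolding p q lo.simps hi.simps by (auto split: if_splits)
    then show ?thesis using 1 p' q' by (auto simp: p q spans_overlap_def)
  next
    case 2
    then have "min y k < max y' k'" "min y' k' < max y k"
      using lt p' q' unfolding p q lo.simps hi.simps by (auto split: if_splits)
    then show ?thesis using 2 p' q' by (auto simp: p q spans_overlap_def)
  next
    case 3
    then have "lo p \<ge> 0" "hi q \<le> 0" unfolding p q by auto
    then show ?thesis using lt by simp
  next
    case 4
    then have "lo q \<ge> 0" "hi p \<le> 0" unfolding p q by auto
    then show ?thesis using lt by simp
  qed
qed

text \<open>The gap must be strict: \<open>(0, 1, 1, -1)\<close> and \<open>(0, 0, 1, -1)\<close>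
  unfold to intervals that touch at 0, yet they share a segment of the negative vertical axis. A gap
  around 0 keeps one of the paths away from the origin.\<close>

lemma not_corner_adj_if_unfolded_disjoint:
  assumes "proper_corner p" "proper_corner q" "meets_axes p" "meets_axes q" "hi p < lo q"
  shows "\<not> corner_adj p q"
proof -
  obtain x y h k where p: "p = (x, y, h, k)" by (metis prod_cases4)
  obtain x' y' h' k' where q: "q = (x', y', h', k')" by (metis prod_cases4)
  note p' = assms(1,3)[unfolded p, simplified] and q' = assms(2,4)[unfolded q, simplified]
  show ?thesis
  proof (cases "x' = 0 \<and> max y' k' > 0")
    case True
    then have lt: "hi p < - max y' k'" using assms(5) by (simp add: q)
    have "\<not> (y = 0 \<and> max x h > 0)"
      using lt True by (auto simp: p)
    then have "x = 0" "max y' k' < max 0 (min y k)" using lt p' by (auto simp: p)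
    then have "max y' k' < min y k" using True by linarith
    then show ?thesis using \<open>x = 0\<close> p' q' True by (auto simp: p q spans_overlap_def)
  next
    case False
    then have "lo q = max 0 (min x' h')" "y' = 0" "max x' h' > 0" using q' by (auto simp: q)
    then have "max 0 (min x' h') > hi p" using assms by simp
    show ?thesis
    proof (cases "y = 0 \<and> max x h > 0")
      case True
      then have "max x h < min x' h'" using \<open>max 0 (min x' h') > hi p\<close> by (auto simp: p)
      then show ?thesis by (auto simp: p q spans_overlap_def)
    next
      case F: False
      then have "x = 0" "max y k > 0" using p' by (auto simp: p)
      have "max 0 (min x' h') > - max 0 (min y k)"
        using F \<open>max 0 (min x' h') > hi p\<close> by (auto simp: p)
      then have "min x' h' > 0 \<or> min y k > 0" by linarith
      then show ?thesis
      proof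
        assume "min x' h' > 0"
        then show ?thesis using \<open>x = 0\<close> \<open>y' = 0\<close> p' q' F by (auto simp: p q spans_overlap_def)
      next
        assume "min y k > 0"
        then show ?thesis using \<open>x = 0\<close> \<open>y' = 0\<close> p' q' F False by (auto simp: p q spans_overlap_def)
      qed
    qed
  qed
qed
text \<open>
  The complement of a 5-cycle is again a 5-cycle. Non-adjacent intervals are ordered, and two consecutive
  comparisons \<open>i < j < k\<close> in the complement would separate the adjacent pair \<open>i\<close>, \<open>k\<close>. So the comparisons
  alternate in direction around an odd cycle.
\<close>

lemma five_cycle_not_interval:
  fixes lo hi :: "nat \<Rightarrow> real"
  assumes 0: "lo 1 < hi 1" "lo 2 < hi 2" "lo 3 < hi 3" "lo 4 < hi 4" "lo 5 < hi 5"
    and 1: "lo 1 \<le> hi 2" "lo 2 \<le> hi 1" "lo 2 \<le> hi 3" "lo 3 \<le> hi 2" "lo 3 \<le> hi 4" "lo 4 \<le> hi 3"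
      "lo 4 \<le> hi 5" "lo 5 \<le> hi 4" "lo 5 \<le> hi 1" "lo 1 \<le> hi 5"
    and 2: "hi 1 \<le> lo 3 \<or> hi 3 \<le> lo 1" "hi 2 \<le> lo 4 \<or> hi 4 \<le> lo 2" "hi 3 \<le> lo 5 \<or> hi 5 \<le> lo 3"
      "hi 4 \<le> lo 1 \<or> hi 1 \<le> lo 4" "hi 5 \<le> lo 2 \<or> hi 2 \<le> lo 5"
  shows False
  using 2 by (elim disjE; use 0 1 in linarith)

lemma corner_adj_commute: "corner_adj p q \<longleftrightarrow> corner_adj q p"
  by (cases p; cases q) (auto simp: spans_overlap_def max.commute min.commute)

lemma no_corner_wheel:
  fixes p :: "nat \<Rightarrow> real \<times> real \<times> real \<times> real"
  assumes proper: "\<And>i. i \<in> {1..5} \<Longrightarrow> proper_corner (p i)"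
    and axes: "\<And>i. i \<in> {1..5} \<Longrightarrow> meets_axes (p i)"
    and adj: "corner_adj (p 1) (p 2)" "corner_adj (p 2) (p 3)" "corner_adj (p 3) (p 4)"
      "corner_adj (p 4) (p 5)" "corner_adj (p 5) (p 1)"
    and nonadj: "\<not> corner_adj (p 1) (p 3)" "\<not> corner_adj (p 2) (p 4)" "\<not> corner_adj (p 3) (p 5)"
      "\<not> corner_adj (p 4) (p 1)" "\<not> corner_adj (p 5) (p 2)"
  shows False
proof -
  have "lo (p i) < hi (p i)" if "i \<in> {1..5}" for i
    using proper axes that lo_less_hi by blast
  from this[of 1] this[of 2] this[of 3] this[of 4] this[of 5]
  have 0: "lo (p 1) < hi (p 1)" "lo (p 2) < hi (p 2)" "lo (p 3) < hi (p 3)" "lo (p 4) < hi (p 4)" "lo (p 5) < hi (p 5)"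
    by auto
  \<comment> \<open>Both unfolding lemmas enter as contrapositives, so touching remains possible for
    adjacent and for non-adjacent pairs.\<close>
  have 1: "lo (p i) \<le> hi (p j) \<and> lo (p j) \<le> hi (p i)"
    if "corner_adj (p i) (p j)" and i: "i \<in> {1..5}" and j: "j \<in> {1..5}" for i j
    using not_corner_adj_if_unfolded_disjoint[OF proper[OF i] proper[OF j] axes[OF i] axes[OF j]]
      not_corner_adj_if_unfolded_disjoint[OF proper[OF j] proper[OF i] axes[OF j] axes[OF i]]
      that corner_adj_commute[of "p i" "p j"] by linarith
  have 2: "hi (p i) \<le> lo (p j) \<or> hi (p j) \<le> lo (p i)"
    if "\<not> corner_adj (p i) (p j)" and i: "i \<in> {1..5}" and j: "j \<in> {1..5}" for i j
    using corner_adj_if_unfolded_overlap[OF proper[OF i] proper[OF j] axes[OF i] axes[OF j]] that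
      lo_less_hi[OF proper[OF i] axes[OF i]] lo_less_hi[OF proper[OF j] axes[OF j]] by linarith
  show False
    by (rule five_cycle_not_interval[of "\<lambda>i. lo (p i)" "\<lambda>i. hi (p i)"])
      (use 0 adj[THEN 1] nonadj[THEN 2] in \<open>simp_all\<close>)
qed

text \<open>Reflection reverses the order of the ends of a span, which \<open>spans_overlap\<close>
  ignores; translation preserves all comparisons.\<close>

lemma corner_adj_reflect:
  assumes "\<sigma> = 1 \<or> \<sigma> = -1" "\<tau> = 1 \<or> \<tau> = -1"
  shows "corner_adj (\<sigma> * (x - X), \<tau> * (y - Y), \<sigma> * (h - X), \<tau> * (k - Y))
      (\<sigma> * (x' - X), \<tau> * (y' - Y), \<sigma> * (h' - X), \<tau> * (k' - Y)) \<longleftrightarrow>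
    corner_adj (x, y, h, k) (x', y', h', k')"
proof -
  have *: "spans_overlap (\<sigma> * (a - Z)) (\<sigma> * (b - Z)) (\<sigma> * (c - Z)) (\<sigma> * (d - Z)) \<longleftrightarrow> spans_overlap a b c d"
    if "\<sigma> = 1 \<or> \<sigma> = -1" for \<sigma> a b c d Z :: real
    using that by (auto simp: spans_overlap_def min_less_iff_disj less_max_iff_disj)
  show ?thesis using assms by (auto simp: *)
qed

section \<open>The wheel with five spokes\<close>

definition star5 :: "nat pair_pre_digraph" where
  "star5 = \<lparr>pverts = {0..5}, parcs = {0} \<times> {1..5} \<union> {1..5} \<times> {0}\<rparr>"

definition rim5 :: "(nat \<times> nat) list" where
  "rim5 = [(1, 2), (2, 3), (3, 4), (4, 5), (5, 1)]"

definition cycle5 :: "nat pair_pre_digraph" where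
  "cycle5 = \<lparr>pverts = {1..5}, parcs = set rim5 \<union> (set rim5)\<inverse>\<rparr>"

definition wheel5 :: "nat pair_pre_digraph" where
  "wheel5 = \<lparr>pverts = pverts star5 \<union> pverts cycle5, parcs = parcs star5 \<union> parcs cycle5\<rparr>"

lemma numeral_set_5: "{0..5} = {0, 1, 2, 3, 4, 5 :: nat}" "{1..5} = {1, 2, 3, 4, 5 :: nat}"
  by auto

lemma wheel5_not_EPG_1: "\<not> EPG_graph 1 wheel5"
proof
  assume "EPG_graph 1 wheel5"
  then obtain P where P: "EPG_representation 1 wheel5 P" unfolding EPG_graph_def by blast
  have "\<exists>x y h k. h \<noteq> x \<and> k \<noteq> y \<and>
      path_image (P u) = grid_set {(y, min x h, max x h)} {(x, min y k, max y k)}"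
    if "u \<in> {0..5}" for u
  proof -
    have "bend_path 1 (P u)" using P that by (auto simp: EPG_representation_def wheel5_def star5_def)
    then show ?thesis by (rule bend_path_1_grid) blast
  qed
  then obtain x y h k where xyhk: "\<And>u. u \<in> {0..5} \<Longrightarrow> h u \<noteq> x u \<and> k u \<noteq> y u \<and>
      path_image (P u) = grid_set {(y u, min (x u) (h u), max (x u) (h u))} {(x u, min (y u) (k u), max (y u) (k u))}"
    by metis
  define q where "q u = (x u, y u, h u, k u)" for u
  have q: "corner_adj (q u) (q v) \<longleftrightarrow> (u, v) \<in> parcs wheel5" if "u \<in> {0..5}" "v \<in> {0..5}" "u \<noteq> v" for u v
  proof -
    have "u \<in> pverts wheel5" "v \<in> pverts wheel5"
      using that by (auto simp: wheel5_def star5_def)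
    then have "(u, v) \<in> parcs wheel5 \<longleftrightarrow> share_segment (P u) (P v)"
      using P that unfolding EPG_representation_def by blast
    also have "\<dots> \<longleftrightarrow> corner_adj (q u) (q v)"
      by (subst share_segment_grid[OF conjunct2[OF conjunct2[OF xyhk]] conjunct2[OF conjunct2[OF xyhk]]])
        (use that in \<open>auto simp: overlap_def q_def spans_overlap_def\<close>)
    finally show ?thesis by blast
  qed
  \<comment> \<open>Reflect so that the path of the hub has its corner at the origin and points to the right and up.\<close>
  define \<sigma> where "\<sigma> = (if h 0 > x 0 then 1 else -1 :: real)"
  define \<tau> where "\<tau> = (if k 0 > y 0 then 1 else -1 :: real)"
  define p where "p u = (\<sigma> * (x u - x 0), \<tau> * (y u - y 0), \<sigma> * (h u - x 0), \<tau> * (k u - y 0))" for u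
  have \<sigma>\<tau>: "\<sigma> = 1 \<or> \<sigma> = -1" "\<tau> = 1 \<or> \<tau> = -1" by (auto simp: \<sigma>_def \<tau>_def)
  have p: "corner_adj (p u) (p v) \<longleftrightarrow> (u, v) \<in> parcs wheel5" if "u \<in> {0..5}" "v \<in> {0..5}" "u \<noteq> v" for u v
    unfolding q[OF that, symmetric] p_def q_def by (rule corner_adj_reflect[OF \<sigma>\<tau>])
  have proper: "proper_corner (p u)" if "u \<in> {0..5}" for u
    using xyhk[OF that] \<sigma>\<tau> by (auto simp: p_def)
  have "meets_axes (p u)" if "u \<in> {1..5}" for u
  proof -
    have "corner_adj (p 0) (p u)"
      using p[of 0 u] that by (auto simp: wheel5_def star5_def)
    moreover have "\<sigma> * (h 0 - x 0) > 0" "\<tau> * (k 0 - y 0) > 0"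
      using xyhk[of 0] by (auto simp: \<sigma>_def \<tau>_def mult_less_0_iff)
    \<comment> \<open>The reflected hub has its corner at the origin and positive leg ends, so a
      span overlapping one of its legs reaches a positive coordinate on that axis.\<close>
    ultimately show ?thesis
      unfolding p_def corner_adj.simps meets_axes.simps spans_overlap_def by auto
  qed
  then show False
    by (rule no_corner_wheel[of p, rotated])
      (use p in \<open>auto intro!: proper simp: wheel5_def star5_def cycle5_def rim5_def\<close>)
qed

section \<open>A straight-line drawing of the wheel\<close>

lemma planar_straight_line:
  fixes pos :: "'a \<Rightarrow> complex"
  assumes G: "pair_graph G" and inj: "inj_on pos (pverts G)" and E: "parcs G = E \<union> E\<inverse>"
    and verts: "\<And>u v w. (u, v) \<in> E \<Longrightarrow> w \<in> pverts G \<Longrightarrow> pos w \<in> closed_segment (pos u) (pos v) \<Longrightarrow> w = u \<or> w = v"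
    and cross: "\<And>u v x y z. (u, v) \<in> E \<Longrightarrow> (x, y) \<in> E \<Longrightarrow> (u, v) \<noteq> (x, y) \<Longrightarrow>
      z \<in> closed_segment (pos u) (pos v) \<Longrightarrow> z \<in> closed_segment (pos x) (pos y) \<Longrightarrow> z \<in> pos ` ({u, v} \<inter> {x, y})"
  shows "planar G"
proof -
  interpret pair_graph G by fact
  define curve where "curve = (\<lambda>(u, v). linepath (pos u) (pos v))"
  have ends: "u \<in> pverts G" "v \<in> pverts G" "u \<noteq> v" if "(u, v) \<in> parcs G" for u v
    using that wellformed' pair_no_loops by fastforce+
  \<comment> \<open>\<open>E\<close> is meant to hold one orientation of each edge; with both,
    \<open>cross\<close> would fail for an edge and its reverse. So an arbitrary arc is first
    replaced by the chosen orientation.\<close>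
  have dir: "\<exists>u' v'. (u', v') \<in> E \<and> {u, v} = {u', v'} \<and> closed_segment (pos u) (pos v) = closed_segment (pos u') (pos v')"
    if "(u, v) \<in> parcs G" for u v
    using that E closed_segment_commute[of "pos u" "pos v"] by (cases "(u, v) \<in> E") blast+
  have 1: "Path_Connected.arc (curve (u, v)) \<and>
        pathstart (curve (u, v)) = pos u \<and> pathfinish (curve (u, v)) = pos v \<and>
        path_image (curve (v, u)) = path_image (curve (u, v)) \<and>
        path_image (curve (u, v)) \<inter> pos ` pverts G = {pos u, pos v}" if uv: "(u, v) \<in> parcs G" for u v
  proof -
    have "pos u \<noteq> pos v" using ends[OF uv] inj by (auto simp: inj_on_def)
    moreover have "closed_segment (pos u) (pos v) \<inter> pos ` pverts G \<subseteq> {pos u, pos v}"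
      using dir[OF uv] verts by fastforce
    ultimately show ?thesis
      using ends[OF uv] by (auto simp: curve_def closed_segment_commute)
  qed
  have 2: "path_image (curve (u, v)) \<inter> path_image (curve (x, y)) = pos ` ({u, v} \<inter> {x, y})"
    if "(u, v) \<in> parcs G" "(x, y) \<in> parcs G" "{u, v} \<noteq> {x, y}" for u v x y
  proof -
    obtain u' v' where u': "(u', v') \<in> E" "{u, v} = {u', v'}" "closed_segment (pos u) (pos v) = closed_segment (pos u') (pos v')"
      using dir \<open>(u, v) \<in> parcs G\<close> by blast
    obtain x' y' where x': "(x', y') \<in> E" "{x, y} = {x', y'}" "closed_segment (pos x) (pos y) = closed_segment (pos x') (pos y')"
      using dir \<open>(x, y) \<in> parcs G\<close> by blast
    have "(u', v') \<noteq> (x', y')" using that(3) u' x' by blast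
    then have "closed_segment (pos u) (pos v) \<inter> closed_segment (pos x) (pos y) \<subseteq> pos ` ({u, v} \<inter> {x, y})"
      unfolding u' x' using cross[OF u'(1) x'(1)] by blast
    moreover have "pos ` ({u, v} \<inter> {x, y}) \<subseteq> closed_segment (pos u) (pos v) \<inter> closed_segment (pos x) (pos y)"
      by auto
    ultimately show ?thesis by (simp add: curve_def)
  qed
  show ?thesis
    unfolding planar_def using inj 1 2 by (intro exI[of _ pos] exI[of _ curve]) blast
qed

text \<open>The rim runs counterclockwise round the hub at the origin. The coordinates make every
  edge horizontal, vertical or of slope 1 or -1.\<close>

definition pos5 :: "nat \<Rightarrow> complex" where
  "pos5 i = [Complex 0 0, Complex 1 0, Complex 0 1, Complex (-1) 0, Complex (-1) (-1), Complex 0 (-1)] ! i"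

lemma pos5_simps [simp]:
  "pos5 0 = Complex 0 0" "pos5 1 = Complex 1 0" "pos5 (Suc 0) = Complex 1 0" "pos5 2 = Complex 0 1"
  "pos5 3 = Complex (-1) 0" "pos5 4 = Complex (-1) (-1)" "pos5 5 = Complex 0 (-1)"
  by (simp_all add: pos5_def numeral_eq_Suc)

text \<open>The four edges of the drawing that are neither horizontal nor vertical, as linear
  conditions by which crossings can be excluded. Each witness is the fraction of the segment
  traversed at \<open>z\<close>.\<close>

lemma closed_segment_diagonals:
  "closed_segment (Complex 0 0) (Complex (-1) (-1)) = {z. Re z = Im z \<and> -1 \<le> Re z \<and> Re z \<le> 0}"
  "closed_segment (Complex 1 0) (Complex 0 1) = {z. Re z + Im z = 1 \<and> 0 \<le> Re z \<and> Re z \<le> 1}"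
  "closed_segment (Complex 0 1) (Complex (-1) 0) = {z. Im z = Re z + 1 \<and> -1 \<le> Re z \<and> Re z \<le> 0}"
  "closed_segment (Complex 0 (-1)) (Complex 1 0) = {z. Im z = Re z - 1 \<and> 0 \<le> Re z \<and> Re z \<le> 1}"
proof -
  have "z \<in> closed_segment (Complex 0 0) (Complex (-1) (-1))" if "Re z = Im z \<and> -1 \<le> Re z \<and> Re z \<le> 0" for z
    using that by (auto simp: in_segment complex_eq_iff intro!: exI[of _ "- Im z"])
  then show "closed_segment (Complex 0 0) (Complex (-1) (-1)) = {z. Re z = Im z \<and> -1 \<le> Re z \<and> Re z \<le> 0}"
    by (auto simp: in_segment)
  have "z \<in> closed_segment (Complex 1 0) (Complex 0 1)" if "Re z + Im z = 1 \<and> 0 \<le> Re z \<and> Re z \<le> 1" for z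
    using that by (auto simp: in_segment complex_eq_iff intro!: exI[of _ "Im z"])
  then show "closed_segment (Complex 1 0) (Complex 0 1) = {z. Re z + Im z = 1 \<and> 0 \<le> Re z \<and> Re z \<le> 1}"
    by (auto simp: in_segment)
  have "z \<in> closed_segment (Complex 0 1) (Complex (-1) 0)" if "Im z = Re z + 1 \<and> -1 \<le> Re z \<and> Re z \<le> 0" for z
    using that by (auto simp: in_segment complex_eq_iff intro!: exI[of _ "- Re z"])
  then show "closed_segment (Complex 0 1) (Complex (-1) 0) = {z. Im z = Re z + 1 \<and> -1 \<le> Re z \<and> Re z \<le> 0}"
    by (auto simp: in_segment)
  have "z \<in> closed_segment (Complex 0 (-1)) (Complex 1 0)" if "Im z = Re z - 1 \<and> 0 \<le> Re z \<and> Re z \<le> 1" for z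
    using that by (auto simp: in_segment complex_eq_iff intro!: exI[of _ "Re z"])
  then show "closed_segment (Complex 0 (-1)) (Complex 1 0) = {z. Im z = Re z - 1 \<and> 0 \<le> Re z \<and> Re z \<le> 1}"
    by (auto simp: in_segment)
qed

section \<open>The wheel as a Halin graph\<close>

lemma pair_graph_star5: "pair_graph star5"
  by unfold_locales (auto simp: star5_def symmetric_def sym_def)

lemma pair_graph_cycle5: "pair_graph cycle5"
  by unfold_locales (auto simp: cycle5_def rim5_def symmetric_def sym_def)

lemma pair_graph_wheel5: "pair_graph wheel5"
  by unfold_locales (auto simp: wheel5_def star5_def cycle5_def rim5_def symmetric_def sym_def)

lemma planar_wheel5: "planar wheel5"
proof (rule planar_straight_line[OF pair_graph_wheel5])
  let ?E = "{(0, 1), (0, 2), (0, 3), (0, 4), (0, 5), (1, 2), (2, 3), (3, 4), (4, 5), (5, 1)} :: (nat \<times> nat) set"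
  note segs = closed_segment_horizontal closed_segment_vertical closed_segment_diagonals
  have verts: "pverts wheel5 = {0, 1, 2, 3, 4, 5}"
    by (auto simp: wheel5_def star5_def cycle5_def)
  show "inj_on pos5 (pverts wheel5)"
    unfolding verts by (auto simp: complex_eq_iff)
  show "parcs wheel5 = ?E \<union> ?E\<inverse>"
    unfolding wheel5_def star5_def cycle5_def rim5_def numeral_set_5 by auto
  show "w = u \<or> w = v" if "(u, v) \<in> ?E" "w \<in> pverts wheel5" "pos5 w \<in> closed_segment (pos5 u) (pos5 v)" for u v w
    using that unfolding verts by (auto simp: segs complex_eq_iff)
  show "z \<in> pos5 ` ({u, v} \<inter> {x, y})"
    if "(u, v) \<in> ?E" "(x, y) \<in> ?E" "(u, v) \<noteq> (x, y)"
      "z \<in> closed_segment (pos5 u) (pos5 v)" "z \<in> closed_segment (pos5 x) (pos5 y)" for u v x y z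
    using that by (auto simp: segs complex_eq_iff)
qed

lemma tree_graph_star5: "tree_graph star5"
proof -
  interpret pair_graph star5 by (rule pair_graph_star5)
  have to: "(u, 0) \<in> rtrancl_on (pverts star5) ((parcs star5)\<^sup>s)" and frm: "(0, u) \<in> rtrancl_on (pverts star5) ((parcs star5)\<^sup>s)"
    if "u \<in> pverts star5" for u
  proof -
    have "u = 0 \<or> (u, 0) \<in> (parcs star5)\<^sup>s \<and> (0, u) \<in> (parcs star5)\<^sup>s" "0 \<in> pverts star5"
      using that by (auto simp: star5_def symcl_def)
    then show "(u, 0) \<in> rtrancl_on (pverts star5) ((parcs star5)\<^sup>s)" "(0, u) \<in> rtrancl_on (pverts star5) ((parcs star5)\<^sup>s)"
      using that by (auto intro: rtrancl_on_into_rtrancl_on)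
  qed
  have "Digraph_Component.connected (with_proj star5)"
    unfolding connected_conv using rtrancl_on_trans[OF to frm] by (auto simp: star5_def)
  moreover have "\<not> simple_cycle star5 p" for p
  proof
    assume "simple_cycle star5 p"
    then obtain u where u: "set p \<subseteq> parcs star5" "pcas u p u" "distinct (tl (pawalk_verts u p))" "3 \<le> length p"
      by (auto simp: simple_cycle_def cycle_def awalk_def)
    \<comment> \<open>Every second vertex of a walk in the star is the hub. If the walk starts at
      the hub, the hub recurs after two arcs and again at the end; otherwise it occurs after one arc
      and after three. Either way \<open>tl\<close> of the vertex list is not distinct.\<close>
    then obtain a b c d e f q where p: "p = (a, b) # (c, d) # (e, f) # q"
      by (auto simp: numeral_3_eq_3 Suc_le_length_iff)
    have "last (pawalk_verts w q) = u" if "pcas w q u" for w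
      using that by (induction q arbitrary: w) auto
    then have "last (pawalk_verts f q) = u" using u(2) by (simp add: p)
    moreover have "last (pawalk_verts f q) \<in> set (pawalk_verts f q)"
      by (intro last_in_set) (cases q, auto)
    ultimately have "u \<in> set (pawalk_verts f q)" by simp
    moreover have "f \<in> set (pawalk_verts f q)" using u(2) by (cases q) (auto simp: p)
    ultimately show False
      using u by (auto simp: p star5_def)
  qed
  ultimately show ?thesis unfolding tree_graph_def using pair_graph_star5 by blast
qed

lemma cycle_graph_cycle5: "cycle_graph cycle5"
proof -
  interpret pair_graph cycle5 by (rule pair_graph_cycle5)
  have "simple_cycle cycle5 rim5"
    unfolding simple_cycle_def cycle_def awalk_def
    by (intro conjI exI[of _ 1]) (auto simp: rim5_def cycle5_def)
  then show ?thesis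
    unfolding cycle_graph_def using pair_graph_cycle5
    by (intro conjI exI[of _ rim5]) (auto simp: cycle5_def rim5_def)
qed

lemma leaves_star5: "leaves star5 = {1..5}"
proof -
  have "{w. (0, w) \<in> parcs star5} = {1..5}"
    by (auto simp: star5_def)
  then have "vertex_degree star5 0 = 5"
    by (simp add: vertex_degree_eq)
  moreover have "{w. (v, w) \<in> parcs star5} = {0}" if "v \<in> {1..5}" for v
    using that by (auto simp: star5_def)
  then have "vertex_degree star5 v = 1" if "v \<in> {1..5}" for v
    using that by (simp add: vertex_degree_eq)
  moreover have "pverts star5 = insert 0 {1..5}" by (auto simp: star5_def)
  ultimately show ?thesis by (auto simp: leaves_def)
qed

lemma halin_graph_wheel5: "halin_graph wheel5"
proof -
  have "vertex_degree wheel5 v \<noteq> 2" if "v \<in> pverts wheel5" for v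
  proof -
    interpret pair_graph wheel5 by (rule pair_graph_wheel5)
    have "\<exists>S. S \<subseteq> {w. (v, w) \<in> parcs wheel5} \<and> card S = 3"
    proof -
      have "v \<in> {0, 1, 2, 3, 4, 5}" using that by (auto simp: wheel5_def star5_def cycle5_def)
      then consider "v = 0" | "v = 1" | "v = 2" | "v = 3" | "v = 4" | "v = 5" by blast
      then show ?thesis
      proof cases
        case 1 then show ?thesis by (intro exI[of _ "{1, 2, 3}"]) (auto simp: wheel5_def star5_def)
      next
        case 2 then show ?thesis by (intro exI[of _ "{0, 2, 5}"]) (auto simp: wheel5_def star5_def cycle5_def rim5_def)
      next
        case 3 then show ?thesis by (intro exI[of _ "{0, 1, 3}"]) (auto simp: wheel5_def star5_def cycle5_def rim5_def)
      next
        case 4 then show ?thesis by (intro exI[of _ "{0, 2, 4}"]) (auto simp: wheel5_def star5_def cycle5_def rim5_def)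
      next
        case 5 then show ?thesis by (intro exI[of _ "{0, 3, 5}"]) (auto simp: wheel5_def star5_def cycle5_def rim5_def)
      next
        case 6 then show ?thesis by (intro exI[of _ "{0, 1, 4}"]) (auto simp: wheel5_def star5_def cycle5_def rim5_def)
      qed
    qed
    moreover have "finite {w. (v, w) \<in> parcs wheel5}"
      by (rule finite_subset[OF _ pair_finite_verts]) (auto dest: wellformed')
    ultimately have "3 \<le> vertex_degree wheel5 v"
      unfolding vertex_degree_eq by (metis card_mono)
    then show ?thesis by simp
  qed
  moreover have "pverts cycle5 = leaves star5"
    by (simp add: leaves_star5 cycle5_def)
  then have "tree_union_cycle_graph wheel5"
    unfolding tree_union_cycle_graph_def
    using pair_graph_wheel5 planar_wheel5 tree_graph_star5 cycle_graph_cycle5 wheel5_def by blast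
  ultimately show ?thesis unfolding halin_graph_def by blast
qed

theorem theorem2:
  shows "(\<forall>G :: 'a pair_pre_digraph. tree_union_cycle_graph G \<longrightarrow> EPG_graph 2 G) \<and>
    (\<exists>H :: nat pair_pre_digraph. halin_graph H \<and> \<not> EPG_graph 1 H)"
  using tree_union_cycle_graph_EPG_2 halin_graph_wheel5 wheel5_not_EPG_1 by blast

end
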